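(* Let $X$ be a separable Hilbert space and let $A:D(A)\subset X\to X$ be a densely defined linear operator such that: (a) $A$ is self-adjoint; (b) $\langle Ax,x\rangle\ge0$ for all $x\in D(A)$; (c) there is $\lambda>0$ such that $(\lambda I+A)^{-1}:X\to X$ is compact. Let $B:X\to X$ be a bounded linear operator. Let $\{A,B\}$ be $1$-null controllable in any time $T>0$, with control cost satisfying, for some constants $\nu,T_0>0$, $$N(\tau)\le e^{\nu/\tau}\qquad\text{for all }0<\tau\le T_0.$$ Then for any $R>0$ there exists $T_R>0$ such that for all $u_0\in X$ with $$\|u_0-\langle u_0,\varphi_1\rangle\varphi_1\|\le R\,|\langle u_0,\varphi_1\rangle|,$$ the system $$u'(t)+Au(t)+p(t)Bu(t)=0,\quad t>0,\qquad u(0)=u_0,$$ is exactly controllable in time $T_R$ to $\phi_1(t)=\langle u_0,\varphi_1\rangle\psi_1(t)$, where $\psi_1(t)=e^{-\lambda_1t}\varphi_1$; i.e. there exists $p\in L^2(0,T_R)$ such that the solution satisfies $u(T_R)=\phi_1(T_R)$.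
   Context: $\mathbb{N}^*=\{1,2,3,\dots\}$. The spectrum of $A$ consists of a sequence of eigenvalues $\{\lambda_k\}_{k\in\mathbb{N}^*}$, ordered so that $0\le\lambda_k\le\lambda_{k+1}\to\infty$, and $\{\varphi_k\}_{k\in\mathbb{N}^*}$ are corresponding eigenfunctions, $A\varphi_k=\lambda_k\varphi_k$, $\|\varphi_k\|=1$, forming an orthonormal basis of $X$. Controls $p$ are scalar functions of time. Solutions are mild solutions: $u\in C([0,T];X)$ with $u(t)=e^{-tA}u_0-\int_0^te^{-(t-s)A}p(s)Bu(s)\,ds$. For $y_0\in X$, $p\in L^2(0,T)$, let $y(\cdot;y_0,p)$ be the mild solution of the linear problem $y'(t)+Ay(t)+p(t)B\varphi_1=0$ on $[0,T]$, $y(0)=y_0$. The pair $\{A,B\}$ is $1$-null controllable in time $T>0$ if there is a constant $N_T>0$ such that for every $y_0\in X$ there is $p\in L^2(0,T)$ with $\|p\|_{L^2(0,T)}\le N_T\|y_0\|$ and $y(T;y_0,p)=0$. The control cost is $$N(T)=\sup_{\|y_0\|=1}\inf\{\|p\|_{L^2(0,T)}: y(T;y_0,p)=0\}.$$ *)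

theory Defs
  imports "HOL-Analysis.Analysis"
begin

text \<open>
  An unbounded operator is a pair of a domain \<open>D\<close> and a total function \<open>A\<close> of which only the
  values on \<open>D\<close> matter. The sort \<open>{real_inner, banach, second_countable_topology}\<close> is that of
  real separable Hilbert spaces.
\<close>

definition linear_operator_on :: "'a::real_vector set \<Rightarrow> ('a \<Rightarrow> 'a) \<Rightarrow> bool" where
  "linear_operator_on D A \<longleftrightarrow> subspace D \<and>
     (\<forall>x\<in>D. \<forall>y\<in>D. A (x + y) = A x + A y) \<and> (\<forall>c. \<forall>x\<in>D. A (c *\<^sub>R x) = c *\<^sub>R A x)"

definition densely_defined :: "'a::topological_space set \<Rightarrow> bool" where
  "densely_defined D \<longleftrightarrow> closure D = UNIV"

text \<open>
  Adjoint of a densely defined operator; density makes the vector \<open>z\<close> below unique.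
\<close>

definition adjoint_domain :: "'a::real_inner set \<Rightarrow> ('a \<Rightarrow> 'a) \<Rightarrow> 'a set" where
  "adjoint_domain D A = {y. \<exists>z. \<forall>x\<in>D. inner (A x) y = inner x z}"

definition adjoint_operator :: "'a::real_inner set \<Rightarrow> ('a \<Rightarrow> 'a) \<Rightarrow> 'a \<Rightarrow> 'a" where
  "adjoint_operator D A y = (THE z. \<forall>x\<in>D. inner (A x) y = inner x z)"

definition self_adjoint :: "'a::real_inner set \<Rightarrow> ('a \<Rightarrow> 'a) \<Rightarrow> bool" where
  "self_adjoint D A \<longleftrightarrow> adjoint_domain D A = D \<and> (\<forall>y\<in>D. adjoint_operator D A y = A y)"

definition compact_operator :: "('a::real_normed_vector \<Rightarrow> 'b::real_normed_vector) \<Rightarrow> bool" where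
  "compact_operator K \<longleftrightarrow> bounded_linear K \<and> (\<forall>S. bounded S \<longrightarrow> compact (closure (K ` S)))"

definition has_compact_inverse :: "'a::real_normed_vector set \<Rightarrow> ('a \<Rightarrow> 'a) \<Rightarrow> bool" where
  "has_compact_inverse D L \<longleftrightarrow> bij_betw L D UNIV \<and> compact_operator (inv_into D L)"

text \<open>Sequences are indexed by the positive integers; the values at \<open>0\<close> are irrelevant.\<close>

definition orthonormal_basis_seq :: "(nat \<Rightarrow> 'a::real_inner) \<Rightarrow> bool" where
  "orthonormal_basis_seq \<phi> \<longleftrightarrow>
     (\<forall>j\<ge>1. \<forall>k\<ge>1. inner (\<phi> j) (\<phi> k) = (if j = k then 1 else 0)) \<and>
     closure (span (\<phi> ` {1..})) = UNIV"

definition eigenbasis ::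
  "'a::real_inner set \<Rightarrow> ('a \<Rightarrow> 'a) \<Rightarrow> (nat \<Rightarrow> real) \<Rightarrow> (nat \<Rightarrow> 'a) \<Rightarrow> bool" where
  "eigenbasis D A lam \<phi> \<longleftrightarrow>
     (\<forall>k\<ge>1. 0 \<le> lam k \<and> lam k \<le> lam (Suc k)) \<and> filterlim lam at_top sequentially \<and>
     (\<forall>k\<ge>1. \<phi> k \<in> D \<and> A (\<phi> k) = lam k *\<^sub>R \<phi> k) \<and> orthonormal_basis_seq \<phi>"

definition C0_semigroup :: "(real \<Rightarrow> 'a::real_normed_vector \<Rightarrow> 'a) \<Rightarrow> bool" where
  "C0_semigroup S \<longleftrightarrow>
     (\<forall>t\<ge>0. bounded_linear (S t)) \<and> (\<forall>x. S 0 x = x) \<and>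
     (\<forall>s\<ge>0. \<forall>t\<ge>0. \<forall>x. S (s + t) x = S s (S t x)) \<and>
     (\<forall>x. ((\<lambda>t. S t x) \<longlongrightarrow> x) (at_right 0))"

definition has_generator ::
  "(real \<Rightarrow> 'a::real_normed_vector \<Rightarrow> 'a) \<Rightarrow> 'a set \<Rightarrow> ('a \<Rightarrow> 'a) \<Rightarrow> bool" where
  "has_generator S D G \<longleftrightarrow>
     (\<forall>x y. ((\<lambda>t. (S t x - x) /\<^sub>R t) \<longlongrightarrow> y) (at_right 0) \<longleftrightarrow> x \<in> D \<and> y = G x)"

text \<open>
  \<open>exp_neg D A t\<close> is the operator \<open>e\<^sup>-\<^sup>t\<^sup>A\<close>, i.e. the \<open>C\<^sub>0\<close>-semigroup generated by \<open>-A\<close>. A generator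
  determines its semigroup for \<open>t \<ge> 0\<close>; only such \<open>t\<close> are used.
\<close>

definition exp_neg :: "'a::real_normed_vector set \<Rightarrow> ('a \<Rightarrow> 'a) \<Rightarrow> real \<Rightarrow> 'a \<Rightarrow> 'a" where
  "exp_neg D A = (SOME S. C0_semigroup S \<and> has_generator S D (\<lambda>x. - A x))"

text \<open>
  \<open>L\<^sup>2(0,T)\<close> is represented by Borel functions; every class modulo null sets contains one, and
  nothing below distinguishes functions that agree almost everywhere.
\<close>

definition L2 :: "real \<Rightarrow> (real \<Rightarrow> real) set" where
  "L2 T = {p. set_borel_measurable lborel {0..T} p \<and> set_integrable lborel {0..T} (\<lambda>t. (p t)\<^sup>2)}"

definition L2_norm :: "real \<Rightarrow> (real \<Rightarrow> real) \<Rightarrow> real" where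
  "L2_norm T p = sqrt (LINT t:{0..T}|lborel. (p t)\<^sup>2)"

text \<open>
  Mild solution on \<open>[0,T]\<close> of \<open>u' + A u + f = 0\<close>, \<open>u(0) = u\<^sub>0\<close>.
\<close>

definition mild_solution ::
  "'a::{real_inner, banach, second_countable_topology} set \<Rightarrow> ('a \<Rightarrow> 'a) \<Rightarrow> real \<Rightarrow>
   'a \<Rightarrow> (real \<Rightarrow> 'a) \<Rightarrow> (real \<Rightarrow> 'a) \<Rightarrow> bool" where
  "mild_solution D A T u0 f u \<longleftrightarrow> continuous_on {0..T} u \<and>
     (\<forall>t\<in>{0..T}. set_integrable lborel {0..t} (\<lambda>s. exp_neg D A (t - s) (f s)) \<and>
        u t = exp_neg D A t u0 - (LINT s:{0..t}|lborel. exp_neg D A (t - s) (f s)))"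

text \<open>
  In the next three definitions \<open>b\<close> stands for \<open>B \<phi>\<^sub>1\<close>.
\<close>

definition steers_to_zero ::
  "'a::{real_inner, banach, second_countable_topology} set \<Rightarrow> ('a \<Rightarrow> 'a) \<Rightarrow> 'a \<Rightarrow> real \<Rightarrow>
   'a \<Rightarrow> (real \<Rightarrow> real) \<Rightarrow> bool" where
  "steers_to_zero D A b T y0 p \<longleftrightarrow>
     (\<exists>y. mild_solution D A T y0 (\<lambda>t. p t *\<^sub>R b) y \<and> y T = 0)"

definition one_null_controllable ::
  "'a::{real_inner, banach, second_countable_topology} set \<Rightarrow> ('a \<Rightarrow> 'a) \<Rightarrow> 'a \<Rightarrow> real \<Rightarrow> bool" where
  "one_null_controllable D A b T \<longleftrightarrow>
     (\<exists>N>0. \<forall>y0. \<exists>p\<in>L2 T. L2_norm T p \<le> N * norm y0 \<and> steers_to_zero D A b T y0 p)"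

definition control_cost ::
  "'a::{real_inner, banach, second_countable_topology} set \<Rightarrow> ('a \<Rightarrow> 'a) \<Rightarrow> 'a \<Rightarrow> real \<Rightarrow> ereal" where
  "control_cost D A b T =
     (SUP y0\<in>{y. norm y = 1}. INF p\<in>{p \<in> L2 T. steers_to_zero D A b T y0 p}. ereal (L2_norm T p))"

text \<open>
  Steering \<open>u' + A u + p B u = 0\<close>, \<open>u(0) = u\<^sub>0\<close> to the trajectory \<open>\<phi>\<close> in time \<open>T\<close>.
\<close>

definition exactly_controllable_to ::
  "'a::{real_inner, banach, second_countable_topology} set \<Rightarrow> ('a \<Rightarrow> 'a) \<Rightarrow> ('a \<Rightarrow> 'a) \<Rightarrow> real \<Rightarrow>
   'a \<Rightarrow> (real \<Rightarrow> 'a) \<Rightarrow> bool" where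
  "exactly_controllable_to D A B T u0 \<phi> \<longleftrightarrow>
     (\<exists>p\<in>L2 T. \<exists>u. mild_solution D A T u0 (\<lambda>t. p t *\<^sub>R B (u t)) u \<and> u T = \<phi> T)"

definition eigensolution :: "(nat \<Rightarrow> real) \<Rightarrow> (nat \<Rightarrow> 'a::real_vector) \<Rightarrow> nat \<Rightarrow> real \<Rightarrow> 'a" where
  "eigensolution lam \<phi> k t = exp (- lam k * t) *\<^sub>R \<phi> k"

end

theory Submission
  imports Defs
begin

text \<open>
  Why the theorem holds. Normalise \<open>\<langle>u\<^sub>0, \<phi>\<^sub>1\<rangle> = 1\<close> and pass from \<open>u\<close> to \<open>e\<^sup>\<mu>\<^sup>t u\<close>, where \<open>\<mu>\<close> is the
  smallest eigenvalue. This replaces \<open>A\<close> by \<open>A - \<mu>\<close>, whose semigroup \<open>S\<close> is still contractive, and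
  turns the eigensolution into the constant \<open>\<phi>\<^sub>1\<close>. It remains to steer a bilinear equation to
  an equilibrium.

  Null controllability forces \<open>\<mu>\<close> to be a simple eigenvalue (\<open>spectral_gap\<close>). Hence, without
  any control, the state approaches \<open>\<phi>\<^sub>1\<close> at an exponential rate (\<open>shifted_decay\<close>), and after a
  waiting time that depends on \<open>R\<close> only it is as close to \<open>\<phi>\<^sub>1\<close> as desired.

  The rest of the way is Newton's method spread over time. Divide an interval of finite length
  into steps of lengths \<open>\<tau>\<^sub>n\<close> that shrink like \<open>(2/3)\<^sup>n\<close>. In step \<open>n\<close> use the control that would
  bring the linearised equation exactly to the equilibrium. The bilinear equation misses it by
  at most \<open>K N(\<tau>\<^sub>n)\<^sup>2 d\<^sup>2\<close>, where \<open>d\<close> is the distance at the beginning of the step and \<open>N\<close> the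
  cost (\<open>newton_step\<close>). The cost \<open>e\<^sup>\<nu>\<^sup>/\<^sup>\<tau>\<close> makes \<open>ln N(\<tau>\<^sub>n)\<close> grow like \<open>(3/2)\<^sup>n\<close>, whereas squaring
  alone would make \<open>- ln d\<close> grow like \<open>2\<^sup>n\<close>. So the distances tend to \<open>0\<close>, the \<open>L\<^sup>2\<close> norms of the
  controls are square summable, and the equilibrium is reached at the end of the interval
  (\<open>exact_control\<close>, \<open>local_exact_control\<close>).

  The operators \<open>e\<^sup>-\<^sup>t\<^sup>A\<close> enter only through their coefficients in the eigenbasis. As \<open>exp_neg\<close> is
  a choice among all semigroups generated by \<open>- A\<close>, this needs two facts: the diagonal semigroup
  is one of them (\<open>has_generator_heat\<close>), and all of them are diagonal (\<open>semigroup_coeffs\<close>).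
\<close>


section \<open>Orthonormal bases and diagonal operators\<close>

locale hilbert_basis =
  fixes e :: "nat \<Rightarrow> 'a::{real_inner, banach}"
  assumes orthonormal: "inner (e j) (e k) = (if j = k then 1 else 0)"
    and dense: "closure (span (range e)) = UNIV"
begin

lemma inner_sum_basis:
  assumes "finite F"
  shows "inner (\<Sum>k\<in>F. c k *\<^sub>R e k) (e j) = (if j \<in> F then c j else 0)"
  using assms by (simp add: inner_sum_left orthonormal if_distrib sum.delta cong: if_cong)

lemma norm_sum_basis:
  assumes "finite F"
  shows "(norm (\<Sum>k\<in>F. c k *\<^sub>R e k))\<^sup>2 = (\<Sum>k\<in>F. (c k)\<^sup>2)"
proof -
  have "(norm (\<Sum>k\<in>F. c k *\<^sub>R e k))\<^sup>2 = (\<Sum>k\<in>F. c k * inner (\<Sum>k\<in>F. c k *\<^sub>R e k) (e k))"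
    by (simp add: power2_norm_eq_inner inner_sum_right)
  also have "\<dots> = (\<Sum>k\<in>F. (c k)\<^sup>2)"
    by (intro sum.cong) (simp_all add: inner_sum_basis[OF assms] power2_eq_square)
  finally show ?thesis .
qed

lemma bessel:
  assumes "finite F"
  shows "(\<Sum>k\<in>F. (inner x (e k))\<^sup>2) \<le> (norm x)\<^sup>2"
proof -
  let ?p = "\<Sum>k\<in>F. inner x (e k) *\<^sub>R e k"
  have "inner x ?p = (norm ?p)\<^sup>2"
    unfolding norm_sum_basis[OF assms] by (simp add: inner_sum_right power2_eq_square)
  then have "0 \<le> (norm x)\<^sup>2 - (norm ?p)\<^sup>2"
    using norm_ge_zero[of "x - ?p"] zero_le_power2[of "norm (x - ?p)"]
    by (simp add: power2_norm_eq_inner inner_diff inner_commute)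
  then show ?thesis
    by (simp add: norm_sum_basis[OF assms])
qed

text \<open>
  Contractions need to be tested on a dense set only. This gives the basis expansion here, and
  later the strong continuity and the generator of \<open>e\<^sup>-\<^sup>t\<^sup>A\<close>.
\<close>

lemma tendsto_on_basis_extend:
  assumes lin: "\<And>t. bounded_linear (U t)" and bound: "\<forall>\<^sub>F t in F. \<forall>x. norm (U t x) \<le> norm x"
    and conv: "\<And>k. ((\<lambda>t. U t (e k)) \<longlongrightarrow> e k) F"
  shows "((\<lambda>t. U t x) \<longlongrightarrow> x) F"
proof -
  have span: "((\<lambda>t. U t y) \<longlongrightarrow> y) F" if "y \<in> span (range e)" for y
    using that
  proof (induction rule: span_induct_alt)
    case base
    then show ?case by (simp add: linear_0[OF bounded_linear.linear[OF lin]])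
  next
    case (step c z y)
    then obtain k where "z = e k" by blast
    then show ?case
      using step conv[of k]
      by (auto intro!: tendsto_intros simp: linear_add[OF bounded_linear.linear[OF lin]]
          linear_scale[OF bounded_linear.linear[OF lin]])
  qed
  show ?thesis
  proof (rule tendstoI)
    fix r :: real assume "r > 0"
    then obtain y where y: "y \<in> span (range e)" "dist y x < r / 3"
      using dense closure_approachable[of x "span (range e)"] by (metis UNIV_I divide_pos_pos zero_less_numeral)
    have "\<forall>\<^sub>F t in F. dist (U t y) y < r / 3"
      using tendstoD[OF span[OF y(1)], of "r/3"] \<open>r > 0\<close> by simp
    with bound show "\<forall>\<^sub>F t in F. dist (U t x) x < r"
    proof eventually_elim
      case (elim t)
      have "dist (U t x) (U t y) = norm (U t (x - y))"
        by (simp add: dist_norm linear_diff[OF bounded_linear.linear[OF lin]])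
      also have "\<dots> \<le> dist y x"
        using elim(1) by (metis dist_norm dist_commute)
      finally show ?case
        using elim(2) y(2) dist_triangle[of "U t x" x "U t y"] dist_triangle[of "U t y" x y] by simp
    qed
  qed
qed

lemma expansion: "(\<lambda>k. inner x (e k) *\<^sub>R e k) sums x"
  unfolding sums_def
proof (rule tendsto_on_basis_extend)
  fix n show "bounded_linear (\<lambda>x. \<Sum>k<n. inner x (e k) *\<^sub>R e k)"
    by (intro bounded_linear_sum bounded_linear_intros)
next
  have "norm (\<Sum>k<n. inner x (e k) *\<^sub>R e k) \<le> norm x" for n x
    by (rule power2_le_imp_le) (simp_all add: norm_sum_basis bessel)
  then show "\<forall>\<^sub>F n in sequentially. \<forall>x. norm (\<Sum>k<n. inner x (e k) *\<^sub>R e k) \<le> norm x"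
    by simp
next
  fix j
  have "(\<Sum>k<n. inner (e j) (e k) *\<^sub>R e k) = e j" if "j < n" for n
    using that by (simp add: orthonormal if_distrib[of "\<lambda>c. c *\<^sub>R _"] sum.delta cong: if_cong)
  then show "(\<lambda>n. \<Sum>k<n. inner (e j) (e k) *\<^sub>R e k) \<longlonglongrightarrow> e j"
    by (intro tendsto_eventually eventually_sequentiallyI[of "Suc j"]) auto
qed

lemma parseval_inner: "(\<lambda>k. inner x (e k) * inner y (e k)) sums inner x y"
  using bounded_linear.sums[OF bounded_linear_inner_left expansion[of x], of y] 
  by (simp add: inner_commute)

lemma parseval_norm: "(\<lambda>k. (inner x (e k))\<^sup>2) sums (norm x)\<^sup>2"
  using parseval_inner[of x x] unfolding power2_norm_eq_inner power2_eq_square[of "inner _ _"] .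

lemma basis_eqI: "(\<And>k. inner x (e k) = inner y (e k)) \<Longrightarrow> x = y"
  using sums_unique2[OF expansion[of x]] expansion[of y] by simp

lemma norm_le_of_coeffs:
  assumes "\<And>k. \<bar>inner y (e k)\<bar> \<le> c * \<bar>inner x (e k)\<bar>" and "0 \<le> c"
  shows "norm y \<le> c * norm x"
proof -
  have "(inner y (e k))\<^sup>2 \<le> c\<^sup>2 * (inner x (e k))\<^sup>2" for k
    using power_mono[OF assms(1)[of k] abs_ge_zero, of 2] by (simp add: power_mult_distrib)
  then have "(norm y)\<^sup>2 \<le> c\<^sup>2 * (norm x)\<^sup>2"
    by (rule sums_le[OF _ parseval_norm sums_mult[OF parseval_norm]])
  then show ?thesis
    using power2_le_imp_le[of "norm y" "c * norm x"] assms(2) by (simp add: power_mult_distrib)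
qed

text \<open>
  Riesz--Fischer: the prescribed coefficients are dominated by those of \<open>x\<close>, hence square
  summable, and the orthogonal series converges.
\<close>

lemma multiplier_exists:
  assumes "\<And>k. \<bar>m k\<bar> \<le> 1"
  shows "\<exists>y. \<forall>k. inner y (e k) = m k * inner x (e k)"
proof -
  let ?f = "\<lambda>k. (m k * inner x (e k)) *\<^sub>R e k"
  have "summable ?f"
    unfolding summable_Cauchy
  proof (intro allI impI)
    fix r :: real assume "r > 0"
    then obtain N where N: "norm (\<Sum>k\<in>{i..<n}. (inner x (e k))\<^sup>2) < r\<^sup>2" if "i \<ge> N" for i n
      using parseval_norm[of x, THEN sums_summable] unfolding summable_Cauchy
      by (metis zero_less_power)
    have "norm (sum ?f {i..<n}) < r" if "i \<ge> N" for i n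
    proof -
      have "(m k * inner x (e k))\<^sup>2 \<le> (inner x (e k))\<^sup>2" for k
        using assms[of k] by (simp add: power_mult_distrib mult_left_le_one_le abs_square_le_1)
      then have "(norm (sum ?f {i..<n}))\<^sup>2 \<le> (\<Sum>k\<in>{i..<n}. (inner x (e k))\<^sup>2)"
        by (simp add: norm_sum_basis sum_mono)
      also have "\<dots> < r\<^sup>2"
        using N[OF that, of n] by simp
      finally show ?thesis
        using \<open>r > 0\<close> power_less_imp_less_base less_imp_le by blast
    qed
    then show "\<exists>N. \<forall>i\<ge>N. \<forall>n. norm (sum ?f {i..<n}) < r" by blast
  qed
  then have "(\<lambda>k. inner (?f k) (e j)) sums inner (suminf ?f) (e j)" for j
    by (intro bounded_linear.sums[OF bounded_linear_inner_left] summable_sums)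
  moreover have "(\<lambda>k. inner (?f k) (e j)) = (\<lambda>k. if k = j then m k * inner x (e k) else 0)" for j
    by (auto simp: orthonormal)
  ultimately have "inner (suminf ?f) (e j) = m j * inner x (e j)" for j
    using sums_unique2[OF _ sums_single[of j "\<lambda>k. m k * inner x (e k)"]] by simp
  then show ?thesis by blast
qed

definition multiplier :: "(nat \<Rightarrow> real) \<Rightarrow> 'a \<Rightarrow> 'a" where
  "multiplier m x = (SOME y. \<forall>k. inner y (e k) = m k * inner x (e k))"

lemma inner_multiplier:
  assumes "\<And>k. \<bar>m k\<bar> \<le> 1"
  shows "inner (multiplier m x) (e k) = m k * inner x (e k)"
  unfolding multiplier_def using someI_ex[OF multiplier_exists[of m, OF assms]] by blast

lemma norm_multiplier_le:
  assumes "\<And>k. \<bar>m k\<bar> \<le> 1"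
  shows "norm (multiplier m x) \<le> norm x"
  using norm_le_of_coeffs[of "multiplier m x" 1 x]
  by (simp add: inner_multiplier[OF assms] abs_mult mult_left_le_one_le assms)

lemma bounded_linear_multiplier:
  assumes "\<And>k. \<bar>m k\<bar> \<le> 1"
  shows "bounded_linear (multiplier m)"
  by (rule bounded_linear_intro[where K = 1])
    (auto intro!: basis_eqI simp: inner_multiplier[OF assms] inner_add_left algebra_simps
      norm_multiplier_le[OF assms])

lemma multiplier_basis:
  assumes "\<And>k. \<bar>m k\<bar> \<le> 1"
  shows "multiplier m (e j) = m j *\<^sub>R e j"
  by (rule basis_eqI) (simp add: inner_multiplier[OF assms] orthonormal)

lemma multiplier_tendsto:
  assumes "\<And>t k. \<bar>m t k\<bar> \<le> 1" and "\<And>k. ((\<lambda>t. m t k) \<longlongrightarrow> 1) F"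
  shows "((\<lambda>t. multiplier (m t) x) \<longlongrightarrow> x) F"
proof (rule tendsto_on_basis_extend)
  show "\<forall>\<^sub>F t in F. \<forall>x. norm (multiplier (m t) x) \<le> norm x"
    using norm_multiplier_le assms(1) by simp
  show "((\<lambda>t. multiplier (m t) (e k)) \<longlongrightarrow> e k) F" for k
    using tendsto_scaleR[OF assms(2)[of k] tendsto_const[of "e k"]]
    by (simp add: multiplier_basis assms(1))
qed (rule bounded_linear_multiplier[OF assms(1)])

end

section \<open>Semigroups on eigenvectors of their generator\<close>

lemma C0_semigroupD:
  assumes "C0_semigroup S"
  shows "0 \<le> t \<Longrightarrow> bounded_linear (S t)" and "S 0 x = x"
    and "0 \<le> s \<Longrightarrow> 0 \<le> t \<Longrightarrow> S (s + t) x = S s (S t x)"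
    and "((\<lambda>t. S t x) \<longlongrightarrow> x) (at_right 0)"
  using assms unfolding C0_semigroup_def by blast+

text \<open>
  Banach--Steinhaus for a semigroup: every \<open>x\<close> lies in one of the closed sets
  \<open>\<Inter>t\<in>{0..1/(n+1)}. {x. norm (S t x) \<le> n}\<close>, because the orbit of \<open>x\<close> is bounded near \<open>0\<close>. By
  Baire's theorem one of them has an interior point.
\<close>

lemma C0_semigroup_locally_bounded:
  fixes S :: "real \<Rightarrow> 'a::banach \<Rightarrow> 'a"
  assumes S: "C0_semigroup S"
  shows "\<exists>\<delta>>0. \<exists>M\<ge>0. \<forall>t\<in>{0..\<delta>}. \<forall>x. norm (S t x) \<le> M * norm x"
proof -
  define F where "F n = (\<Inter>t\<in>{0..1 / real (Suc n)}. {x. norm (S t x) \<le> real n})" for n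
  have closed: "closed (F n)" for n
    unfolding F_def
    by (intro closed_INT ballI closed_Collect_le continuous_intros
        bounded_linear.continuous_on[OF C0_semigroupD(1)[OF S]]) auto
  have cover: "\<exists>n. x \<in> F n" for x
  proof -
    have "\<forall>\<^sub>F t in at_right 0. norm (S t x) < norm x + 1"
      using tendsto_norm[OF C0_semigroupD(4)[OF S, of x]] by (rule order_tendstoD) simp
    then obtain b where b: "b > 0" "\<And>t. 0 < t \<Longrightarrow> t < b \<Longrightarrow> norm (S t x) < norm x + 1"
      unfolding eventually_at_right_field by blast
    obtain n1 where n1: "1 / real (Suc n1) < b"
      using nat_approx_posE[OF b(1)] by blast
    obtain n2 where n2: "norm x + 1 \<le> real n2"
      using real_arch_simple by blast
    define n where "n = max n1 n2"
    have "1 / real (Suc n) \<le> 1 / real (Suc n1)"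
      by (intro divide_left_mono) (auto simp: n_def)
    moreover have "norm x + 1 \<le> real n"
      using n2 by (simp add: n_def)
    ultimately have "norm (S t x) \<le> real n" if "t \<in> {0..1 / real (Suc n)}" for t
      using that b(2)[of t] n1 C0_semigroupD(2)[OF S, of x] by (cases "t = 0") auto
    then have "x \<in> F n"
      unfolding F_def by blast
    then show ?thesis by blast
  qed
  have "\<exists>n. interior (F n) \<noteq> {}"
  proof (rule ccontr)
    assume *: "\<not> ?thesis"
    have "Met_TC.mtopology interior_of \<Union> (range F) = {}"
      by (rule Met_TC.metric_Baire_category_alt) (use * closed in \<open>auto simp: complete_UNIV\<close>)
    moreover have "\<Union> (range F) = UNIV" using cover by blast
    ultimately show False by simp
  qed
  then obtain n y r where r: "r > 0" "cball y r \<subseteq> F n"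
    by (meson all_not_in_conv mem_interior_cball)
  have bound: "norm (S t x) \<le> (2 * real n / r) * norm x" if t: "t \<in> {0..1 / real (Suc n)}" for t x
  proof (cases "x = 0")
    case True
    then show ?thesis
      using linear_0[OF bounded_linear.linear[OF C0_semigroupD(1)[OF S]], of t] t by simp
  next
    case False
    interpret St: bounded_linear "S t" using C0_semigroupD(1)[OF S] t by simp
    define z where "z = (r / norm x) *\<^sub>R x"
    have z: "norm z = r" using False r by (simp add: z_def)
    have "y + z \<in> F n" "y \<in> F n"
      using r z by (auto simp: dist_norm intro!: subsetD[OF r(2)])
    then have "norm (S t (y + z)) \<le> n" "norm (S t y) \<le> n"
      using t unfolding F_def by auto
    then have "norm (S t z) \<le> 2 * n"
      using norm_triangle_ineq4[of "S t (y + z)" "S t y"] by (simp add: St.add)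
    then have "(r / norm x) * norm (S t x) \<le> 2 * n"
      using r by (simp add: z_def St.scale)
    then show ?thesis using False r by (simp add: field_simps)
  qed
  then show ?thesis
    using r by (intro exI[of _ "1 / real (Suc n)"] conjI exI[of _ "2 * real n / r"]) auto
qed

lemma difference_quotient_exp:
  "((\<lambda>t. (exp (- c * t) - 1) / t) \<longlongrightarrow> - c) (at_right (0::real))"
proof -
  have "((\<lambda>t. exp (- c * t)) has_field_derivative - c) (at 0 within {0<..})"
    by (auto intro!: derivative_eq_intros)
  then show ?thesis by (simp add: has_field_derivative_iff)
qed

text \<open>
  With \<open>E h = e\<^sup>-\<^sup>\<mu>\<^sup>h\<close>, telescoping bounds the error of \<open>S (n h) v = E (n h) v\<close> by \<open>n\<close> errors at
  \<open>h = t / n\<close>, each of them \<open>o(1/n)\<close> because \<open>S\<close> and \<open>E\<close> have the same derivative at \<open>0\<close>. Local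
  boundedness controls the factors \<open>S (k h)\<close> of the telescoping sum. A differential equation for
  \<open>S t v\<close> would be no shortcut: only right derivatives are given by the definition, and left
  continuity needs local boundedness as well.
\<close>

lemma semigroup_eigenvector:
  fixes S :: "real \<Rightarrow> 'a::banach \<Rightarrow> 'a"
  assumes S: "C0_semigroup S" and gen: "has_generator S D (\<lambda>x. - A x)"
    and v: "v \<in> D" "A v = \<mu> *\<^sub>R v" and "0 \<le> \<mu>" and "0 \<le> t"
  shows "S t v = exp (- \<mu> * t) *\<^sub>R v"
proof -
  note D = C0_semigroupD[OF S]
  obtain \<delta> M where \<delta>: "\<delta> > 0" and M: "M \<ge> 0" "\<And>t x. t \<in> {0..\<delta>} \<Longrightarrow> norm (S t x) \<le> M * norm x"
    using C0_semigroup_locally_bounded[OF S] by blast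
  define err where "err h = S h v - exp (- \<mu> * h) *\<^sub>R v" for h
  have iter: "S (real (Suc n) * h) v = S (real n * h) (S h v)" if "h \<ge> 0" for n h
    using D(3)[of "real n * h" h v] that by (simp add: algebra_simps)
  have tele: "norm (err (real n * h)) \<le> real n * (M * norm (err h))"
    if h: "h \<ge> 0" "real n * h \<le> \<delta>" for n h
    using h(2)
  proof (induction n)
    case 0
    then show ?case by (simp add: err_def D)
  next
    case (Suc n)
    have nh: "0 \<le> real n * h" "real n * h \<le> \<delta>"
      using Suc.prems h(1) by (auto simp: algebra_simps)
    interpret Sn: bounded_linear "S (real n * h)" using D(1) nh by simp
    have "err (real (Suc n) * h) = S (real n * h) (err h) + exp (- \<mu> * h) *\<^sub>R err (real n * h)"
      unfolding err_def iter[OF h(1)] Sn.diff Sn.scale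
      by (simp add: algebra_simps flip: exp_add)
    also have "norm \<dots> \<le> M * norm (err h) + 1 * norm (err (real n * h))"
      using M(2)[of "real n * h" "err h"] nh h(1) \<open>0 \<le> \<mu>\<close>
      by (intro norm_triangle_le add_mono) (auto intro!: mult_left_le_one_le)
    also have "\<dots> \<le> real (Suc n) * (M * norm (err h))"
      using Suc.IH nh(2) by (simp add: algebra_simps)
    finally show ?case .
  qed
  have "((\<lambda>h. (S h v - v) /\<^sub>R h) \<longlongrightarrow> - A v) (at_right 0)"
    using gen v(1) unfolding has_generator_def by blast
  then have "((\<lambda>h. (S h v - v) /\<^sub>R h - ((exp (- \<mu> * h) - 1) / h) *\<^sub>R v)
      \<longlongrightarrow> - A v - (- \<mu>) *\<^sub>R v) (at_right 0)"
    by (intro tendsto_intros difference_quotient_exp)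
  moreover have "(S h v - v) /\<^sub>R h - ((exp (- \<mu> * h) - 1) / h) *\<^sub>R v = err h /\<^sub>R h" for h
    by (simp add: err_def divide_inverse algebra_simps)
  ultimately have err0: "((\<lambda>h. err h /\<^sub>R h) \<longlongrightarrow> 0) (at_right 0)"
    by (simp add: v(2))
  \<comment> \<open>Up to time \<open>\<delta>\<close> by telescoping with \<open>n \<rightarrow> \<infinity>\<close>, afterwards by the semigroup law.\<close>
  have small: "err t = 0" if t: "0 < t" "t \<le> \<delta>" for t
  proof -
    have "filterlim (\<lambda>n. t / real n) (at_right 0) sequentially"
      unfolding filterlim_at
      using t(1) lim_const_over_n[of t]
      by (auto intro: eventually_mono[OF eventually_gt_at_top[of 0]])
    then have "(\<lambda>n. norm (err (t / real n) /\<^sub>R (t / real n))) \<longlonglongrightarrow> 0"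
      using filterlim_compose[OF err0] tendsto_norm_zero by blast
    then have "(\<lambda>n. t * M * norm (err (t / real n) /\<^sub>R (t / real n))) \<longlonglongrightarrow> 0"
      using tendsto_mult_left[of _ 0 sequentially "t * M"] by fastforce
    moreover have "\<forall>\<^sub>F n in sequentially. norm (err t) \<le> t * M * norm (err (t / real n) /\<^sub>R (t / real n))"
      using eventually_gt_at_top[of 0]
    proof eventually_elim
      case (elim n)
      then show ?case
        using tele[of "t / real n" n] t by (simp add: field_simps)
    qed
    ultimately have "norm (err t) \<le> 0"
      by (rule tendsto_lowerbound) simp
    then show ?thesis by simp
  qed
  obtain n where n: "t < real n * \<delta>" "n > 0"
    using reals_Archimedean3[OF \<delta>] \<open>0 \<le> t\<close>
    by (metis mult_zero_left not_gr_zero of_nat_0 order_le_less_trans order_less_irrefl)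
  define h where "h = t / real n"
  have h: "0 \<le> h" "h \<le> \<delta>" "t = real n * h"
    using n \<open>0 \<le> t\<close> by (auto simp: h_def field_simps)
  have eh: "S h v = exp (- \<mu> * h) *\<^sub>R v"
    using small[of h] h D(2) by (cases "h = 0") (auto simp: err_def)
  have "S (real k * h) v = exp (- \<mu> * (real k * h)) *\<^sub>R v" for k
  proof (induction k)
    case 0
    then show ?case by (simp add: D)
  next
    case (Suc k)
    interpret Sk: bounded_linear "S (real k * h)" using D(1) h(1) by simp
    show ?case
      unfolding iter[OF h(1)] eh Sk.scale Suc.IH
      by (simp add: algebra_simps flip: exp_add)
  qed
  then show ?thesis by (simp add: h(3))
qed

context hilbert_basis
begin

lemma semigroup_coeffs:
  fixes S :: "real \<Rightarrow> 'a \<Rightarrow> 'a"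
  assumes S: "C0_semigroup S" and gen: "has_generator S D (\<lambda>x. - A x)"
    and eig: "\<And>k. e k \<in> D" "\<And>k. A (e k) = l k *\<^sub>R e k" "\<And>k. 0 \<le> l k" and t: "0 \<le> t"
  shows "inner (S t x) (e k) = exp (- l k * t) * inner x (e k)"
proof -
  have St: "bounded_linear (S t)" using C0_semigroupD(1)[OF S t] .
  have "(\<lambda>j. inner (S t (inner x (e j) *\<^sub>R e j)) (e k)) sums inner (S t x) (e k)"
    by (intro bounded_linear.sums[OF bounded_linear_inner_left] bounded_linear.sums[OF St] expansion)
  moreover have "S t (inner x (e j) *\<^sub>R e j) = (inner x (e j) * exp (- l j * t)) *\<^sub>R e j" for j
    using semigroup_eigenvector[OF S gen eig t, of j] linear_scale[OF bounded_linear.linear[OF St]]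
    by simp
  then have "(\<lambda>j. inner (S t (inner x (e j) *\<^sub>R e j)) (e k)) =
      (\<lambda>j. if j = k then exp (- l j * t) * inner x (e j) else 0)"
    by (auto simp: orthonormal)
  ultimately show ?thesis
    using sums_unique2[OF _ sums_single[of k "\<lambda>j. exp (- l j * t) * inner x (e j)"]] by simp
qed

end

section \<open>The semigroup of a self-adjoint operator with an eigenbasis\<close>

lemma adjoint_operator_eqI:
  assumes "densely_defined D" and z: "\<And>x. x \<in> D \<Longrightarrow> inner (A x) y = inner x z"
  shows "adjoint_operator D A y = z"
  unfolding adjoint_operator_def
proof (rule the_equality)
  fix z' assume z': "\<forall>x\<in>D. inner (A x) y = inner x z'"
  have "continuous_on (closure D) (\<lambda>x. inner x (z' - z))"
    by (intro continuous_intros)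
  then have "inner (z' - z) (z' - z) = 0"
    by (rule continuous_constant_on_closure)
      (use assms z' in \<open>auto simp: inner_diff_right densely_defined_def\<close>)
  then show "z' = z" by simp
qed (use z in blast)

lemma self_adjoint_symmetric:
  assumes "densely_defined D" "self_adjoint D A" "x \<in> D" "y \<in> D"
  shows "inner (A x) y = inner x (A y)"
proof -
  obtain z where z: "\<forall>x\<in>D. inner (A x) y = inner x z"
    using assms unfolding self_adjoint_def adjoint_domain_def by blast
  then have "A y = z"
    using adjoint_operator_eqI[of D A y z] assms unfolding self_adjoint_def by simp
  then show ?thesis using z assms by blast
qed

text \<open>Eigenvalues are indexed from \<open>0\<close> here; \<open>l 0\<close> plays the role of \<open>\<lambda>\<^sub>1\<close>.\<close>

locale eigenbasis_operator = hilbert_basis e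
  for e :: "nat \<Rightarrow> 'a::{real_inner, banach, second_countable_topology}" +
  fixes D :: "'a set" and A :: "'a \<Rightarrow> 'a" and l :: "nat \<Rightarrow> real"
  assumes dense_domain: "densely_defined D" and self_adjoint: "self_adjoint D A"
    and eigen: "e k \<in> D" "A (e k) = l k *\<^sub>R e k" and nonneg: "0 \<le> l k"
begin

lemma coeff_A: "x \<in> D \<Longrightarrow> inner (A x) (e k) = l k * inner x (e k)"
  using self_adjoint_symmetric[OF dense_domain self_adjoint _ eigen(1)] eigen(2) by simp

text \<open>
  Self-adjointness makes \<open>D\<close> as large as possible: it contains every vector to which \<open>A\<close>
  can be applied coefficientwise.
\<close>

lemma mem_domain:
  assumes y: "\<And>k. inner y (e k) = l k * inner x (e k)"
  shows "x \<in> D" and "A x = y"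
proof -
  have "inner (A z) x = inner z y" if z: "z \<in> D" for z
  proof (rule sums_unique2[OF parseval_inner[of "A z" x]])
    show "(\<lambda>k. inner (A z) (e k) * inner x (e k)) sums inner z y"
      using parseval_inner[of z y] by (simp add: coeff_A[OF z] y mult_ac)
  qed
  then show x: "x \<in> D"
    using self_adjoint unfolding self_adjoint_def adjoint_domain_def by blast
  show "A x = y"
    by (rule basis_eqI) (simp add: coeff_A[OF x] y)
qed

text \<open>
  The absolute value gives a multiplier bounded by \<open>1\<close> for every real \<open>t\<close>.
\<close>

definition heat :: "real \<Rightarrow> 'a \<Rightarrow> 'a" where
  "heat t = multiplier (\<lambda>k. exp (- l k * \<bar>t\<bar>))"

lemma exp_le_1: "\<bar>exp (- l k * \<bar>t\<bar>)\<bar> \<le> 1"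
  using nonneg by simp

lemma coeff_heat: "inner (heat t x) (e k) = exp (- l k * \<bar>t\<bar>) * inner x (e k)"
  unfolding heat_def by (rule inner_multiplier) (rule exp_le_1)

lemma C0_semigroup_heat: "C0_semigroup heat"
  unfolding C0_semigroup_def
proof (intro conjI allI impI)
  show "bounded_linear (heat t)" for t
    unfolding heat_def using exp_le_1 by (rule bounded_linear_multiplier)
  show "heat 0 x = x" for x
    by (rule basis_eqI) (simp add: coeff_heat)
  show "heat (s + t) x = heat s (heat t x)" if "0 \<le> s" "0 \<le> t" for s t x
    by (rule basis_eqI) (use that in \<open>simp add: coeff_heat algebra_simps flip: exp_add\<close>)
  show "((\<lambda>t. heat t x) \<longlongrightarrow> x) (at_right 0)" for x
    unfolding heat_def
  proof (rule multiplier_tendsto[OF exp_le_1])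
    fix k
    have "((\<lambda>t. exp (- l k * \<bar>t\<bar>)) \<longlongrightarrow> exp (- l k * \<bar>0\<bar>)) (at_right 0)"
      by (intro tendsto_intros)
    then show "((\<lambda>t. exp (- l k * \<bar>t\<bar>)) \<longlongrightarrow> 1) (at_right 0)" by simp
  qed
qed

text \<open>
  On \<open>D\<close> the difference quotients are \<open>- multiplier (g t) (A x)\<close> with
  \<open>g t k = (1 - e\<^sup>-\<^sup>t\<^sup>l) / (t l)\<close> in \<open>[0, 1]\<close>; conversely, if they converge, the limit has the
  coefficients \<open>- l k * \<langle>x, e k\<rangle>\<close>, which puts \<open>x\<close> into \<open>D\<close>.
\<close>

lemma has_generator_heat: "has_generator heat D (\<lambda>x. - A x)"
  unfolding has_generator_def
proof (intro allI iffI)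
  fix x y assume lim: "((\<lambda>t. (heat t x - x) /\<^sub>R t) \<longlongrightarrow> y) (at_right 0)"
  have "inner (- y) (e k) = l k * inner x (e k)" for k
  proof -
    have "((\<lambda>t. inner ((heat t x - x) /\<^sub>R t) (e k)) \<longlongrightarrow> inner y (e k)) (at_right 0)"
      using lim by (intro tendsto_intros)
    moreover have "((\<lambda>t. inner ((heat t x - x) /\<^sub>R t) (e k)) \<longlongrightarrow> - l k * inner x (e k)) (at_right 0)"
    proof (rule Lim_transform_eventually)
      show "((\<lambda>t. (exp (- l k * t) - 1) / t * inner x (e k)) \<longlongrightarrow> - l k * inner x (e k)) (at_right 0)"
        by (intro tendsto_intros difference_quotient_exp)
      show "\<forall>\<^sub>F t in at_right 0. (exp (- l k * t) - 1) / t * inner x (e k) = inner ((heat t x - x) /\<^sub>R t) (e k)"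
        using eventually_at_right_less[of "0::real"]
        by eventually_elim (simp add: inner_diff_left coeff_heat field_simps)
    qed
    ultimately have "inner y (e k) = - l k * inner x (e k)"
      using tendsto_unique[OF trivial_limit_at_right_real] by blast
    then show ?thesis by simp
  qed
  from mem_domain[OF this] show "x \<in> D \<and> y = - A x" by simp
next
  fix x y assume xy: "x \<in> D \<and> y = - A x"
  define g where "g t k = (if t \<le> 0 \<or> l k = 0 then 1 else (1 - exp (- l k * t)) / (l k * t))" for t k
  have g1: "\<bar>g t k\<bar> \<le> 1" for t k
    using exp_ge_add_one_self[of "- l k * t"] nonneg[of k]
    by (auto simp: g_def not_le less_le)
  have "((\<lambda>t. g t k) \<longlongrightarrow> 1) (at_right 0)" for k
  proof (cases "l k = 0")
    case True
    then show ?thesis by (simp add: g_def)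
  next
    case False
    show ?thesis
    proof (rule Lim_transform_eventually)
      have "((\<lambda>t. (exp (- l k * t) - 1) / t * (- 1 / l k)) \<longlongrightarrow> - l k * (- 1 / l k)) (at_right 0)"
        by (intro tendsto_intros difference_quotient_exp)
      then show "((\<lambda>t. (exp (- l k * t) - 1) / t * (- 1 / l k)) \<longlongrightarrow> 1) (at_right 0)"
        using False by simp
      show "\<forall>\<^sub>F t in at_right 0. (exp (- l k * t) - 1) / t * (- 1 / l k) = g t k"
        using eventually_at_right_less[of "0::real"]
        by eventually_elim (use False in \<open>simp add: g_def field_simps\<close>)
    qed
  qed
  then have "((\<lambda>t. - multiplier (g t) (A x)) \<longlongrightarrow> - A x) (at_right 0)"
    using g1 by (intro tendsto_minus multiplier_tendsto)
  moreover have "- multiplier (g t) (A x) = (heat t x - x) /\<^sub>R t" if "t > 0" for t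
    by (rule basis_eqI)
      (use that xy in \<open>auto simp: inner_multiplier[OF g1] inner_diff_left coeff_heat coeff_A g_def field_simps\<close>)
  then have "\<forall>\<^sub>F t in at_right 0. - multiplier (g t) (A x) = (heat t x - x) /\<^sub>R t"
    using eventually_at_right_less[of "0::real"] by (auto elim: eventually_mono)
  ultimately have "((\<lambda>t. (heat t x - x) /\<^sub>R t) \<longlongrightarrow> - A x) (at_right 0)"
    by (rule Lim_transform_eventually)
  then show "((\<lambda>t. (heat t x - x) /\<^sub>R t) \<longlongrightarrow> y) (at_right 0)"
    using xy by simp
qed

lemma exp_neg: "C0_semigroup (exp_neg D A) \<and> has_generator (exp_neg D A) D (\<lambda>x. - A x)"
  unfolding exp_neg_def
  by (rule someI[of "\<lambda>S. C0_semigroup S \<and> has_generator S D (\<lambda>x. - A x)"])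
    (use C0_semigroup_heat has_generator_heat in blast)

lemmas C0_semigroup_exp_neg = exp_neg[THEN conjunct1]

lemma coeff_exp_neg:
  "0 \<le> t \<Longrightarrow> inner (exp_neg D A t x) (e k) = exp (- l k * t) * inner x (e k)"
  using semigroup_coeffs[OF C0_semigroup_exp_neg exp_neg[THEN conjunct2] eigen nonneg] .

end

section \<open>Duhamel integrals of contraction semigroups\<close>

text \<open>
  The a priori estimate behind both uniqueness (\<open>c = 0\<close>) and the bounds on trajectories: insert
  the maximum of the norm for \<open>M\<close>.
\<close>

lemma norm_le_if_absorbed:
  fixes w :: "real \<Rightarrow> 'a::real_normed_vector"
  assumes cont: "continuous_on {0..T} w" and r: "r \<in> {0..T}"
    and absorb: "\<And>s M. s \<in> {0..T} \<Longrightarrow> (\<And>s. s \<in> {0..T} \<Longrightarrow> norm (w s) \<le> M) \<Longrightarrow> norm (w s) \<le> c + M / 2"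
  shows "norm (w r) \<le> 2 * c"
proof -
  obtain s where s: "s \<in> {0..T}" "\<And>s'. s' \<in> {0..T} \<Longrightarrow> norm (w s') \<le> norm (w s)"
    using continuous_attains_sup[OF _ _ continuous_on_norm[OF cont]] r
    by (metis compact_Icc empty_iff)
  have "norm (w s) \<le> c + norm (w s) / 2"
    by (rule absorb) (use s in auto)
  then show ?thesis using s(2)[OF r] by simp
qed

lemma set_integrable_scaleR_continuous:
  fixes w :: "real \<Rightarrow> 'a::{banach, second_countable_topology}"
  assumes p: "set_integrable lborel {0..T} p" and w: "continuous_on {0..T} w"
  shows "set_integrable lborel {0..T} (\<lambda>s. p s *\<^sub>R w s)"
proof -
  have "bounded (w ` {0..T})"
    by (intro compact_imp_bounded compact_continuous_image w) simp
  then obtain M where M: "\<And>s. s \<in> {0..T} \<Longrightarrow> norm (w s) \<le> M"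
    unfolding bounded_iff by blast
  have [measurable]: "(\<lambda>s. indicator {0..T} s *\<^sub>R p s) \<in> borel_measurable lborel"
    using p unfolding set_integrable_def by (rule borel_measurable_integrable)
  have [measurable]: "(\<lambda>s. indicator {0..T} s *\<^sub>R w s) \<in> borel_measurable lborel"
    using borel_measurable_continuous_on_indicator[OF _ w] by simp
  have eq: "indicator {0..T} s *\<^sub>R (p s *\<^sub>R w s) =
      (indicator {0..T} s *\<^sub>R p s) *\<^sub>R (indicator {0..T} s *\<^sub>R w s)" for s
    by (simp add: indicator_def)
  show ?thesis
    unfolding set_integrable_def
  proof (rule Bochner_Integration.integrable_bound)
    show "integrable lborel (\<lambda>s. (indicator {0..T} s *\<^sub>R p s) * M)"
      using p unfolding set_integrable_def by (rule integrable_mult_left)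
    show "(\<lambda>s. indicator {0..T} s *\<^sub>R (p s *\<^sub>R w s)) \<in> borel_measurable lborel"
      unfolding eq by measurable
    have "norm (p s) * norm (w s) \<le> norm (p s) * \<bar>M\<bar>" if "s \<in> {0..T}" for s
      using M[OF that] by (intro mult_left_mono) auto
    then show "AE s in lborel. norm (indicator {0..T} s *\<^sub>R (p s *\<^sub>R w s)) \<le>
        norm ((indicator {0..T} s *\<^sub>R p s) * M)"
      by (auto simp: indicator_def abs_mult)
  qed
qed

locale contraction_semigroup =
  fixes S :: "real \<Rightarrow> 'a::{banach, second_countable_topology} \<Rightarrow> 'a"
  assumes C0: "C0_semigroup S" and contraction: "0 \<le> t \<Longrightarrow> norm (S t x) \<le> norm x"
begin

lemmas linear_S = C0_semigroupD(1)[OF C0]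
  and S_0 = C0_semigroupD(2)[OF C0]
  and S_add = C0_semigroupD(3)[OF C0]

lemma norm_orbit_diff_le:
  assumes "0 \<le> s" "0 \<le> t"
  shows "norm (S s x - S t x) \<le> norm (S \<bar>s - t\<bar> x - x)"
proof -
  have *: "norm (S s x - S t x) \<le> norm (S (t - s) x - x)" if "0 \<le> s" "s \<le> t" for s t
  proof -
    interpret Ss: bounded_linear "S s" using linear_S that by simp
    have "S s x - S t x = S s (x - S (t - s) x)"
      using S_add[of s "t - s" x] that by (simp add: Ss.diff)
    then show ?thesis
      using contraction[OF that(1), of "x - S (t - s) x"] by (simp add: norm_minus_commute)
  qed
  show ?thesis
    using *[of s t] *[of t s] assms by (cases "s \<le> t") (auto simp: norm_minus_commute)
qed

text \<open>
  Joint continuity in time and state; it makes all integrands below measurable. Cutting off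
  at \<open>0\<close> turns it into a statement about all of \<open>\<real>\<close>.
\<close>

lemma continuous_on_flow: "continuous_on UNIV (\<lambda>z. S (max 0 (fst z)) (snd z))"
proof -
  have at0: "isCont (\<lambda>t. S \<bar>t\<bar> x) 0" for x
  proof -
    have "filterlim (\<lambda>t::real. \<bar>t\<bar>) (at_right 0) (at 0)"
      unfolding filterlim_at by (auto intro!: tendsto_eq_intros simp: eventually_at_filter)
    then show ?thesis
      unfolding isCont_def using filterlim_compose[OF C0_semigroupD(4)[OF C0, of x]]
      by (simp add: S_0)
  qed
  have "isCont (\<lambda>z. S (max 0 (fst z)) (snd z)) p" for p
  proof -
    obtain r x where p: "p = (r, x)" by fastforce
    have bound: "norm (S (max 0 (fst z)) (snd z) - S (max 0 r) x) \<le>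
        norm (snd z - x) + norm (S \<bar>max 0 (fst z) - max 0 r\<bar> x - x)" for z
    proof -
      interpret Sz: bounded_linear "S (max 0 (fst z))" by (rule linear_S) simp
      have "S (max 0 (fst z)) (snd z) - S (max 0 r) x =
          S (max 0 (fst z)) (snd z - x) + (S (max 0 (fst z)) x - S (max 0 r) x)"
        by (simp add: Sz.diff)
      then have "norm (S (max 0 (fst z)) (snd z) - S (max 0 r) x) \<le>
          norm (S (max 0 (fst z)) (snd z - x)) + norm (S (max 0 (fst z)) x - S (max 0 r) x)"
        using norm_triangle_ineq by metis
      also have "\<dots> \<le> norm (snd z - x) + norm (S \<bar>max 0 (fst z) - max 0 r\<bar> x - x)"
        by (intro add_mono contraction norm_orbit_diff_le) auto
      finally show ?thesis .
    qed
    have "((\<lambda>z. max 0 (fst z) - max 0 r) \<longlongrightarrow> max 0 (fst p) - max 0 r) (at p)"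
      by (intro tendsto_intros)
    then have "((\<lambda>z. max 0 (fst z) - max 0 r) \<longlongrightarrow> 0) (at p)"
      by (simp add: p)
    then have "((\<lambda>z. S \<bar>max 0 (fst z) - max 0 r\<bar> x) \<longlongrightarrow> S \<bar>0\<bar> x) (at p)"
      by (rule isCont_tendsto_compose[OF at0])
    then have "((\<lambda>z. norm (snd z - x) + norm (S \<bar>max 0 (fst z) - max 0 r\<bar> x - x)) \<longlongrightarrow>
        norm (snd p - x) + norm (S \<bar>0\<bar> x - x)) (at p)"
      by (intro tendsto_intros)
    then have "((\<lambda>z. norm (snd z - x) + norm (S \<bar>max 0 (fst z) - max 0 r\<bar> x - x)) \<longlongrightarrow> 0) (at p)"
      by (simp add: p S_0)
    then have "((\<lambda>z. S (max 0 (fst z)) (snd z) - S (max 0 r) x) \<longlongrightarrow> 0) (at p)"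
      by (rule Lim_null_comparison[rotated]) (simp add: bound)
    then show ?thesis
      unfolding isCont_def using Lim_null p by auto
  qed
  then show ?thesis by (simp add: continuous_at_imp_continuous_on)
qed

lemma continuous_on_orbit: "continuous_on {0..} (\<lambda>t. S t x)"
proof -
  have "continuous_on {0..} (\<lambda>t. S (max 0 (fst (t, x))) (snd (t, x)))"
    by (rule continuous_on_compose2[OF continuous_on_flow])
      (intro continuous_on_Pair continuous_on_id continuous_on_const, rule subset_UNIV)
  then show ?thesis
    by (rule continuous_on_eq) auto
qed

lemma measurable_flow [measurable (raw)]:
  assumes "f \<in> borel_measurable M" "g \<in> borel_measurable M"
  shows "(\<lambda>s. S (max 0 (f s)) (g s)) \<in> borel_measurable M"
proof -
  have "(\<lambda>s. (f s, g s)) \<in> M \<rightarrow>\<^sub>M borel"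
    using assms unfolding borel_prod[symmetric] by measurable
  from measurable_compose[OF this borel_measurable_continuous_onI[OF continuous_on_flow]]
  show ?thesis by simp
qed

definition duhamel :: "real \<Rightarrow> (real \<Rightarrow> 'a) \<Rightarrow> 'a" where
  "duhamel t g = (LINT s:{0..t}|lborel. S (t - s) (g s))"

lemma measurable_duhamel_integrand:
  assumes "set_borel_measurable lborel {0..t} g"
  shows "(\<lambda>s. indicator {0..t} s *\<^sub>R S (t - s) (g s)) \<in> borel_measurable lborel"
proof -
  have [measurable]: "(\<lambda>s. indicator {0..t} s *\<^sub>R g s) \<in> borel_measurable lborel"
    using assms unfolding set_borel_measurable_def .
  have "(\<lambda>s. indicator {0..t} s *\<^sub>R S (t - s) (g s)) =
      (\<lambda>s. indicator {0..t} s *\<^sub>R S (max 0 (t - s)) (indicator {0..t} s *\<^sub>R g s))"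
    by (auto simp: indicator_def fun_eq_iff)
  also have "\<dots> \<in> borel_measurable lborel"
    by measurable
  finally show ?thesis .
qed

lemma duhamel_integrable:
  assumes g: "set_integrable lborel {0..t} g"
  shows "set_integrable lborel {0..t} (\<lambda>s. S (t - s) (g s))"
  unfolding set_integrable_def
proof (rule Bochner_Integration.integrable_bound)
  show "integrable lborel (\<lambda>s. indicator {0..t} s *\<^sub>R g s)"
    using g unfolding set_integrable_def .
  then show "(\<lambda>s. indicator {0..t} s *\<^sub>R S (t - s) (g s)) \<in> borel_measurable lborel"
    by (intro measurable_duhamel_integrand) (auto simp: set_borel_measurable_def)
  show "AE s in lborel. norm (indicator {0..t} s *\<^sub>R S (t - s) (g s)) \<le> norm (indicator {0..t} s *\<^sub>R g s)"
    by (auto simp: indicator_def contraction)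
qed

lemma norm_duhamel_le:
  assumes g: "set_integrable lborel {0..t} g"
  shows "norm (duhamel t g) \<le> (LINT s:{0..t}|lborel. norm (g s))"
  unfolding duhamel_def set_lebesgue_integral_def
proof (rule order_trans[OF integral_norm_bound integral_mono])
  show "integrable lborel (\<lambda>s. norm (indicator {0..t} s *\<^sub>R S (t - s) (g s)))"
    using duhamel_integrable[OF g] unfolding set_integrable_def by (rule integrable_norm)
  have "integrable lborel (\<lambda>s. norm (indicator {0..t} s *\<^sub>R g s))"
    using g unfolding set_integrable_def by (rule integrable_norm)
  then show "integrable lborel (\<lambda>s. indicator {0..t} s *\<^sub>R norm (g s))"
    by (simp add: norm_scaleR)
  show "norm (indicator {0..t} s *\<^sub>R S (t - s) (g s)) \<le> indicator {0..t} s *\<^sub>R norm (g s)" for s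
    by (auto simp: indicator_def contraction)
qed

lemma norm_duhamel_scaleR_le:
  assumes p: "set_integrable lborel {0..t} p" and w: "continuous_on {0..t} w"
    and M: "\<And>s. s \<in> {0..t} \<Longrightarrow> norm (w s) \<le> M"
  shows "norm (duhamel t (\<lambda>s. p s *\<^sub>R w s)) \<le> (LINT s:{0..t}|lborel. \<bar>p s\<bar>) * M"
proof -
  note pw = set_integrable_scaleR_continuous[OF p w]
  have "norm (duhamel t (\<lambda>s. p s *\<^sub>R w s)) \<le> (LINT s:{0..t}|lborel. norm (p s *\<^sub>R w s))"
    by (rule norm_duhamel_le[OF pw])
  also have "\<dots> \<le> (LINT s:{0..t}|lborel. \<bar>p s\<bar> * M)"
    using set_integrable_norm[OF pw] set_integrable_abs[OF p] M
    by (intro set_integral_mono) (auto intro: mult_left_mono)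
  finally show ?thesis by simp
qed

text \<open>
  Dominated convergence: the integrands at times \<open>t n \<longlonglongrightarrow> a\<close> converge at every \<open>s \<noteq> a\<close>, and \<open>norm (g s)\<close>
  is a common bound by contractivity.
\<close>

lemma continuous_on_duhamel:
  assumes g: "set_integrable lborel {0..T} g"
  shows "continuous_on {0..T} (\<lambda>t. duhamel t g)"
  unfolding continuous_on_sequentially
proof (intro allI ballI impI, elim conjE)
  fix t :: "nat \<Rightarrow> real" and a :: real
  assume a: "a \<in> {0..T}" and t: "\<forall>n. t n \<in> {0..T}" "t \<longlonglongrightarrow> a"
  have "(\<lambda>n. duhamel (t n) g) \<longlonglongrightarrow> duhamel a g"
    unfolding duhamel_def set_lebesgue_integral_def
  proof (rule integral_dominated_convergence[where w = "\<lambda>s. norm (indicator {0..T} s *\<^sub>R g s)"])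
    have sub: "set_integrable lborel {0..b} g" if "b \<in> {0..T}" for b
      by (rule set_integrable_subset[OF g]) (use that in auto)
    show "(\<lambda>s. indicator {0..t n} s *\<^sub>R S (t n - s) (g s)) \<in> borel_measurable lborel" for n
      using duhamel_integrable[OF sub[of "t n"]] t(1) unfolding set_integrable_def
      by (blast intro: borel_measurable_integrable)
    show "(\<lambda>s. indicator {0..a} s *\<^sub>R S (a - s) (g s)) \<in> borel_measurable lborel"
      using duhamel_integrable[OF sub[OF a]] unfolding set_integrable_def
      by (rule borel_measurable_integrable)
    show "integrable lborel (\<lambda>s. norm (indicator {0..T} s *\<^sub>R g s))"
      using g unfolding set_integrable_def by (rule integrable_norm)
    show "AE s in lborel. norm (indicator {0..t n} s *\<^sub>R S (t n - s) (g s)) \<le> norm (indicator {0..T} s *\<^sub>R g s)" for n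
      using t(1) by (auto simp: indicator_def contraction intro: order_trans)
    have "(\<lambda>n. indicator {0..t n} s *\<^sub>R S (t n - s) (g s)) \<longlonglongrightarrow> indicator {0..a} s *\<^sub>R S (a - s) (g s)"
      if "s \<noteq> a" for s
    proof (cases "s < a")
      case True
      have "\<forall>\<^sub>F n in sequentially. s < t n"
        using order_tendstoD(1)[OF t(2) True] .
      then have ev: "\<forall>\<^sub>F n in sequentially. indicator {0..a} s *\<^sub>R S (t n - s) (g s) =
          indicator {0..t n} s *\<^sub>R S (t n - s) (g s)"
        by eventually_elim (use True in \<open>auto simp: indicator_def\<close>)
      have "(\<lambda>n. S (t n - s) (g s)) \<longlonglongrightarrow> S (a - s) (g s)"
        by (rule continuous_on_tendsto_compose[OF continuous_on_orbit])
          (use True t \<open>\<forall>\<^sub>F n in sequentially. s < t n\<close> in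
            \<open>auto intro!: tendsto_intros elim: eventually_mono\<close>)
      then have "(\<lambda>n. indicator {0..a} s *\<^sub>R S (t n - s) (g s)) \<longlonglongrightarrow> indicator {0..a} s *\<^sub>R S (a - s) (g s)"
        by (intro tendsto_intros)
      then show ?thesis using ev by (rule Lim_transform_eventually)
    next
      case False
      with that have "\<forall>\<^sub>F n in sequentially. t n < s"
        using order_tendstoD(2)[OF t(2), of s] by simp
      then have "\<forall>\<^sub>F n in sequentially. indicator {0..t n} s *\<^sub>R S (t n - s) (g s) = 0"
        by eventually_elim auto
      then show ?thesis
        using False that by (auto intro: tendsto_eventually simp: indicator_def)
    qed
    then show "AE s in lborel. (\<lambda>n. indicator {0..t n} s *\<^sub>R S (t n - s) (g s)) \<longlonglongrightarrow>
        indicator {0..a} s *\<^sub>R S (a - s) (g s)"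
      using AE_lborel_singleton[of a] by (auto elim: eventually_mono)
  qed
  then show "((\<lambda>t. duhamel t g) \<circ> t) \<longlonglongrightarrow> duhamel a g"
    by (simp add: o_def)
qed

lemma duhamel_add:
  assumes "set_integrable lborel {0..t} f" "set_integrable lborel {0..t} g"
  shows "duhamel t (\<lambda>s. f s + g s) = duhamel t f + duhamel t g"
proof -
  have "duhamel t (\<lambda>s. f s + g s) = (LINT s:{0..t}|lborel. S (t - s) (f s) + S (t - s) (g s))"
    unfolding duhamel_def
    by (intro set_lebesgue_integral_cong) (auto simp: linear_add[OF bounded_linear.linear[OF linear_S]])
  then show ?thesis
    using duhamel_integrable[OF assms(1)] duhamel_integrable[OF assms(2)] by (simp add: duhamel_def)
qed

lemma duhamel_diff:
  assumes "set_integrable lborel {0..t} f" "set_integrable lborel {0..t} g"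
  shows "duhamel t (\<lambda>s. f s - g s) = duhamel t f - duhamel t g"
proof -
  have "duhamel t (\<lambda>s. f s - g s) = (LINT s:{0..t}|lborel. S (t - s) (f s) - S (t - s) (g s))"
    unfolding duhamel_def
    by (intro set_lebesgue_integral_cong) (auto simp: linear_diff[OF bounded_linear.linear[OF linear_S]])
  then show ?thesis
    using duhamel_integrable[OF assms(1)] duhamel_integrable[OF assms(2)] by (simp add: duhamel_def)
qed

lemma duhamel_cong:
  assumes "\<And>s. s \<in> {0..<t} \<Longrightarrow> f s = g s"
  shows "duhamel t f = duhamel t g"
proof -
  have "duhamel t f = (LINT s:{0..<t}|lborel. S (t - s) (f s))" for f
    unfolding duhamel_def set_lebesgue_integral_def
    by (rule integral_discrete_difference[of "{t}"]) (auto simp: indicator_def)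
  then show ?thesis
    using assms by (auto intro: set_lebesgue_integral_cong)
qed

text \<open>
  Split the integral at \<open>t\<close>; the semigroup law pulls \<open>S r\<close> out of the first part, and the second
  part is translated back to the origin.
\<close>

lemma duhamel_restart:
  assumes t: "0 \<le> t" "0 \<le> r" and g: "set_integrable lborel {0..t + r} g"
  shows "duhamel (t + r) g = S r (duhamel t g) + duhamel r (\<lambda>s. g (t + s))"
proof -
  interpret Sr: bounded_linear "S r" using linear_S t by simp
  let ?f = "\<lambda>s. S (t + r - s) (g s)"
  have f: "set_integrable lborel {0..t + r} ?f"
    by (rule duhamel_integrable[OF g])
  have un: "{0..t + r} = {0..t} \<union> {t..t + r}" using t by auto
  have "duhamel (t + r) g = (LINT s:{0..t}|lborel. ?f s) + (LINT s:{t..t + r}|lborel. ?f s)"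
    unfolding duhamel_def un
  proof (rule set_integral_Un_AE)
    show "AE s in lborel. \<not> (s \<in> {0..t} \<and> s \<in> {t..t + r})"
      using AE_lborel_singleton[of t] by (auto elim: eventually_mono)
    show "set_integrable lborel {0..t} ?f" "set_integrable lborel {t..t + r} ?f"
      by (rule set_integrable_subset[OF f]; use t in auto)+
  qed auto
  moreover have "(LINT s:{0..t}|lborel. ?f s) = S r (duhamel t g)"
  proof -
    have "(LINT s:{0..t}|lborel. ?f s) = (LINT s:{0..t}|lborel. S r (S (t - s) (g s)))"
      using t S_add[of r] by (intro set_lebesgue_integral_cong) (auto simp flip: S_add simp: algebra_simps)
    also have "\<dots> = S r (duhamel t g)"
      unfolding duhamel_def set_lebesgue_integral_def Sr.scale[symmetric]
    proof (rule integral_bounded_linear[OF Sr.bounded_linear_axioms])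
      have "set_integrable lborel {0..t} g"
        by (rule set_integrable_subset[OF g]) (use t in auto)
      then show "integrable lborel (\<lambda>s. indicator {0..t} s *\<^sub>R S (t - s) (g s))"
        using duhamel_integrable unfolding set_integrable_def by blast
    qed
    finally show ?thesis .
  qed
  moreover have "(LINT s:{t..t + r}|lborel. ?f s) = duhamel r (\<lambda>s. g (t + s))"
    unfolding duhamel_def set_lebesgue_integral_def
    by (subst lborel_integral_real_affine[of 1 _ t]) (auto intro!: Bochner_Integration.integral_cong simp: indicator_def)
  ultimately show ?thesis by simp
qed

end

section \<open>Trajectories of the bilinear equation\<close>

locale bilinear_system = contraction_semigroup S
  for S :: "real \<Rightarrow> 'a::{banach, second_countable_topology} \<Rightarrow> 'a" +
  fixes B :: "'a \<Rightarrow> 'a" and \<beta> :: real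
  assumes linear_B: "bounded_linear B" and norm_B: "norm (B x) \<le> \<beta> * norm x" and \<beta>_pos: "0 < \<beta>"
begin

lemmas \<beta>_nonneg = less_imp_le[OF \<beta>_pos]

text \<open>
  Mild solutions for the semigroup \<open>S\<close>. The integrand is integrable if \<open>p\<close> is, since \<open>u\<close> is
  continuous (\<open>integrable_pB\<close>).
\<close>

definition trajectory :: "real \<Rightarrow> 'a \<Rightarrow> (real \<Rightarrow> real) \<Rightarrow> (real \<Rightarrow> 'a) \<Rightarrow> bool" where
  "trajectory T u0 p u \<longleftrightarrow> continuous_on {0..T} u \<and>
     (\<forall>t\<in>{0..T}. u t = S t u0 - duhamel t (\<lambda>s. p s *\<^sub>R B (u s)))"

definition L1_norm :: "real \<Rightarrow> (real \<Rightarrow> real) \<Rightarrow> real" where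
  "L1_norm T p = (LINT s:{0..T}|lborel. \<bar>p s\<bar>)"

lemma L1_norm_nonneg: "0 \<le> L1_norm T p"
  unfolding L1_norm_def set_lebesgue_integral_def by (rule Bochner_Integration.integral_nonneg) (simp add: indicator_def)

lemma L1_norm_mono:
  assumes "set_integrable lborel {0..T} p" "t \<le> T"
  shows "L1_norm t p \<le> L1_norm T p"
proof -
  have "set_integrable lborel {0..t} p"
    by (rule set_integrable_subset[OF assms(1)]) (use assms(2) in auto)
  then show ?thesis
    using set_integrable_abs[OF assms(1)] assms(2) set_integrable_abs[of lborel "{0..t}" p]
    unfolding L1_norm_def set_lebesgue_integral_def set_integrable_def
    by (intro integral_mono) (auto simp: indicator_def)
qed

lemma set_integrable_subinterval:
  fixes f :: "real \<Rightarrow> 'b::{banach, second_countable_topology}"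
  assumes "set_integrable lborel {0..T} f" "t \<le> T"
  shows "set_integrable lborel {0..t} f"
  by (rule set_integrable_subset[OF assms(1)]) (use assms(2) in auto)

lemma continuous_on_B: "continuous_on A u \<Longrightarrow> continuous_on A (\<lambda>s. B (u s))"
  by (rule bounded_linear.continuous_on[OF linear_B])

lemma integrable_pB:
  fixes T :: real
  assumes "set_integrable lborel {0..T} p" "continuous_on {0..T} u"
  shows "set_integrable lborel {0..T} (\<lambda>s. p s *\<^sub>R B (u s))"
  by (rule set_integrable_scaleR_continuous[OF assms(1) continuous_on_B[OF assms(2)]])

lemma norm_duhamel_B_le:
  assumes p: "set_integrable lborel {0..T} p" and w: "continuous_on {0..T} w"
    and M: "\<And>s. s \<in> {0..T} \<Longrightarrow> norm (w s) \<le> M" and t: "t \<in> {0..T}"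
  shows "norm (duhamel t (\<lambda>s. p s *\<^sub>R B (w s))) \<le> \<beta> * L1_norm T p * M"
proof -
  have M0: "0 \<le> M" using M[OF t] norm_ge_zero order_trans by blast
  have "norm (duhamel t (\<lambda>s. p s *\<^sub>R B (w s))) \<le> L1_norm t p * (\<beta> * M)"
    unfolding L1_norm_def
  proof (rule norm_duhamel_scaleR_le)
    show "set_integrable lborel {0..t} p"
      using set_integrable_subinterval[OF p] t by simp
    show "continuous_on {0..t} (\<lambda>s. B (w s))"
      by (rule continuous_on_B, rule continuous_on_subset[OF w]) (use t in auto)
    show "norm (B (w s)) \<le> \<beta> * M" if "s \<in> {0..t}" for s
      using order_trans[OF norm_B mult_left_mono[OF M \<beta>_nonneg], of s] that t by simp
  qed
  also have "\<dots> \<le> L1_norm T p * (\<beta> * M)"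
    using L1_norm_mono[OF p, of t] t M0 \<beta>_nonneg by (intro mult_right_mono) auto
  finally show ?thesis by (simp add: mult_ac)
qed

lemma trajectory_shorten: "trajectory T u0 p u \<Longrightarrow> t \<le> T \<Longrightarrow> trajectory t u0 p u"
  unfolding trajectory_def by (auto intro: continuous_on_subset)

lemma trajectory_cong:
  assumes u: "trajectory T u0 p u" and eq: "\<And>s. s \<in> {0..<T} \<Longrightarrow> p s = q s"
  shows "trajectory T u0 q u"
proof -
  have "duhamel t (\<lambda>s. p s *\<^sub>R B (u s)) = duhamel t (\<lambda>s. q s *\<^sub>R B (u s))" if "t \<in> {0..T}" for t
    by (rule duhamel_cong) (use that eq in auto)
  with u show ?thesis unfolding trajectory_def by simp
qed

lemma trajectory_unique:
  assumes u: "trajectory T u0 p u" and v: "trajectory T u0 p v"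
    and p: "set_integrable lborel {0..T} p" "\<beta> * L1_norm T p \<le> 1 / 2" and t: "t \<in> {0..T}"
  shows "u t = v t"
proof -
  let ?w = "\<lambda>s. u s - v s"
  have cont: "continuous_on {0..T} ?w"
    using u v unfolding trajectory_def by (intro continuous_intros) auto
  have "norm (?w t) \<le> 2 * 0"
  proof (rule norm_le_if_absorbed[OF cont t])
    fix s M assume s: "s \<in> {0..T}" and M: "\<And>s. s \<in> {0..T} \<Longrightarrow> norm (?w s) \<le> M"
    have M0: "0 \<le> M" using M[OF s] norm_ge_zero order_trans by blast
    have sub: "set_integrable lborel {0..s} p" "continuous_on {0..s} u" "continuous_on {0..s} v"
      using set_integrable_subinterval[OF p(1)] u v s unfolding trajectory_def
      by (auto intro: continuous_on_subset)
    have "?w s = duhamel s (\<lambda>s. p s *\<^sub>R B (v s)) - duhamel s (\<lambda>s. p s *\<^sub>R B (u s))"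
      using u v s unfolding trajectory_def by simp
    also have "\<dots> = duhamel s (\<lambda>s. p s *\<^sub>R B (v s) - p s *\<^sub>R B (u s))"
      by (rule duhamel_diff[symmetric]) (intro integrable_pB sub)+
    also have "\<dots> = duhamel s (\<lambda>s. p s *\<^sub>R B (v s - u s))"
      by (simp add: linear_diff[OF bounded_linear.linear[OF linear_B]] scaleR_diff_right)
    also have "norm \<dots> \<le> \<beta> * L1_norm T p * M"
      by (rule norm_duhamel_B_le[OF p(1) _ _ s])
        (use u v M in \<open>auto simp: trajectory_def norm_minus_commute intro: continuous_intros\<close>)
    also have "\<dots> \<le> 0 + M / 2"
      using mult_right_mono[OF p(2) M0] by simp
    finally show "norm (?w s) \<le> 0 + M / 2" .
  qed
  then show ?thesis by simp
qed

text \<open>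
  When \<open>\<beta> * L1_norm T p \<le> 1/2\<close> the mild equation is a contraction in the sup norm on all of
  \<open>[0, T]\<close>. Functions on \<open>[0, T]\<close> are extended by constants so that Banach's theorem can be
  applied in the space of bounded continuous functions on \<open>\<real>\<close>.
\<close>

lemma trajectory_exists:
  assumes T: "0 \<le> T" and p: "set_integrable lborel {0..T} p" "\<beta> * L1_norm T p \<le> 1 / 2"
  shows "\<exists>u. trajectory T u0 p u"
proof -
  define clamp where "clamp t = max 0 (min T t)" for t :: real
  have clamp: "clamp t \<in> {0..T}" for t using T by (auto simp: clamp_def)
  have clamp_id: "clamp t = t" if "t \<in> {0..T}" for t using that by (auto simp: clamp_def)
  have cont_clamp: "continuous_on UNIV clamp" unfolding clamp_def by (intro continuous_intros)
  define \<Phi> where "\<Phi> u t = S t u0 - duhamel t (\<lambda>s. p s *\<^sub>R B (u s))" for u t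
  have cont_\<Phi>: "continuous_on {0..T} (\<Phi> u)" if "continuous_on {0..T} u" for u
    unfolding \<Phi>_def
    by (intro continuous_on_diff continuous_on_duhamel integrable_pB p that
        continuous_on_subset[OF continuous_on_orbit]) auto
  have mem: "(\<lambda>t. \<Phi> (apply_bcontfun u) (clamp t)) \<in> bcontfun" for u
  proof -
    note c = cont_\<Phi>[of "apply_bcontfun u", OF continuous_on_apply_bcontfun]
    have "bounded (\<Phi> (apply_bcontfun u) ` {0..T})"
      by (intro compact_imp_bounded compact_continuous_image c) simp
    then obtain b where "\<forall>t\<in>{0..T}. norm (\<Phi> (apply_bcontfun u) t) \<le> b"
      unfolding bounded_iff by blast
    then show ?thesis
      by (intro bcontfun_normI continuous_on_compose2[OF c cont_clamp]) (use clamp in blast)+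
  qed
  define F where "F u = Bcontfun (\<lambda>t. \<Phi> (apply_bcontfun u) (clamp t))" for u
  have F: "apply_bcontfun (F u) t = \<Phi> (apply_bcontfun u) (clamp t)" for u t
    unfolding F_def using Bcontfun_inverse[OF mem] by simp
  have "dist (F u) (F v) \<le> 1 / 2 * dist u v" for u v
  proof (rule dist_bound)
    fix t
    let ?t = "clamp t"
    have sub: "set_integrable lborel {0..?t} p"
      using set_integrable_subinterval[OF p(1)] clamp by simp
    have "apply_bcontfun (F u) t - apply_bcontfun (F v) t =
        duhamel ?t (\<lambda>s. p s *\<^sub>R B (v s)) - duhamel ?t (\<lambda>s. p s *\<^sub>R B (u s))"
      by (simp add: F \<Phi>_def)
    also have "\<dots> = duhamel ?t (\<lambda>s. p s *\<^sub>R B (v s) - p s *\<^sub>R B (u s))"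
      by (rule duhamel_diff[symmetric]) (intro integrable_pB sub continuous_on_apply_bcontfun)+
    also have "\<dots> = duhamel ?t (\<lambda>s. p s *\<^sub>R B (v s - u s))"
      by (simp add: linear_diff[OF bounded_linear.linear[OF linear_B]] scaleR_diff_right)
    also have "norm \<dots> \<le> \<beta> * L1_norm T p * dist u v"
    proof (rule norm_duhamel_B_le[OF p(1) _ _ clamp])
      show "norm (apply_bcontfun v s - apply_bcontfun u s) \<le> dist u v" for s
        using dist_bounded[of u s v] by (simp add: dist_norm norm_minus_commute)
    qed (intro continuous_on_diff continuous_on_apply_bcontfun)
    also have "\<dots> \<le> 1 / 2 * dist u v"
      by (intro mult_right_mono p(2)) simp
    finally show "dist (apply_bcontfun (F u) t) (apply_bcontfun (F v) t) \<le> 1 / 2 * dist u v"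
      by (simp add: dist_norm)
  qed
  then obtain u where u: "F u = u"
    using banach_fix_type[of "1/2" F] by auto
  have "trajectory T u0 p (apply_bcontfun u)"
    unfolding trajectory_def
  proof (intro conjI ballI continuous_on_apply_bcontfun)
    fix t assume "t \<in> {0..T}"
    then show "apply_bcontfun u t = S t u0 - duhamel t (\<lambda>s. p s *\<^sub>R B (apply_bcontfun u s))"
      using F[of u t] by (simp add: u clamp_id \<Phi>_def)
  qed
  then show ?thesis by blast
qed

lemma trajectory_restart:
  assumes u: "trajectory T u0 p u" and p: "set_integrable lborel {0..T} p"
    and t: "0 \<le> t" "0 \<le> r" "t + r \<le> T"
  shows "trajectory r (u t) (\<lambda>s. p (t + s)) (\<lambda>s. u (t + s))"
  unfolding trajectory_def
proof (intro conjI ballI)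
  have cont: "continuous_on {0..T} u" using u unfolding trajectory_def by simp
  show "continuous_on {0..r} (\<lambda>s. u (t + s))"
    by (rule continuous_on_compose2[OF cont]) (use t in \<open>auto intro: continuous_intros\<close>)
  fix s assume s: "s \<in> {0..r}"
  interpret Ss: bounded_linear "S s" using linear_S s by simp
  let ?g = "\<lambda>s. p s *\<^sub>R B (u s)"
  have g: "set_integrable lborel {0..t + s} ?g"
    using set_integrable_subinterval[OF integrable_pB[OF p cont]] s t by simp
  have "u (t + s) = S (s + t) u0 - duhamel (t + s) ?g" "u t = S t u0 - duhamel t ?g"
    using u s t unfolding trajectory_def by (auto simp: add.commute)
  then show "u (t + s) = S s (u t) - duhamel s (\<lambda>r. p (t + r) *\<^sub>R B (u (t + r)))"
    using S_add[of s t u0] duhamel_restart[OF t(1) _ g] s t(1) by (simp add: Ss.diff)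
qed

text \<open>
  A control that steers the linearised system around the equilibrium \<open>\<phi>\<close> from \<open>u0 - \<phi>\<close> to
  \<open>0\<close> leaves only the quadratic term \<open>\<integral> S (\<tau> - s) (q s B (u s - \<phi>)) ds\<close> of the bilinear system.
\<close>

lemma newton_step:
  assumes u: "trajectory \<tau> u0 q u" and q: "set_integrable lborel {0..\<tau>} q" "\<beta> * L1_norm \<tau> q \<le> 1 / 2"
    and \<phi>: "\<And>t. 0 \<le> t \<Longrightarrow> S t \<phi> = \<phi>" "norm \<phi> = 1" and \<tau>: "0 \<le> \<tau>"
    and steer: "S \<tau> (u0 - \<phi>) = duhamel \<tau> (\<lambda>s. q s *\<^sub>R B \<phi>)"
    and cost: "L1_norm \<tau> q \<le> N * norm (u0 - \<phi>)" "1 \<le> N"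
  shows "norm (u \<tau> - \<phi>) \<le> 2 * \<beta> * (1 + \<beta>) * N\<^sup>2 * (norm (u0 - \<phi>))\<^sup>2"
proof -
  define z where "z = norm (u0 - \<phi>)"
  let ?w = "\<lambda>s. u s - \<phi>" and ?I = "L1_norm \<tau> q"
  have cont_u: "continuous_on {0..\<tau>} u" using u unfolding trajectory_def by simp
  then have cont: "continuous_on {0..\<tau>} ?w" by (intro continuous_intros)
  have w: "?w r = S r (u0 - \<phi>) - duhamel r (\<lambda>s. q s *\<^sub>R B \<phi>) - duhamel r (\<lambda>s. q s *\<^sub>R B (?w s))"
    if r: "r \<in> {0..\<tau>}" for r
  proof -
    have qr: "set_integrable lborel {0..r} q" "continuous_on {0..r} ?w"
      using set_integrable_subinterval[OF q(1)] continuous_on_subset[OF cont, of "{0..r}"] r by auto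
    have "duhamel r (\<lambda>s. q s *\<^sub>R B \<phi> + q s *\<^sub>R B (?w s)) =
        duhamel r (\<lambda>s. q s *\<^sub>R B \<phi>) + duhamel r (\<lambda>s. q s *\<^sub>R B (?w s))"
      by (rule duhamel_add) (intro integrable_pB qr continuous_on_const)+
    moreover have "q s *\<^sub>R B \<phi> + q s *\<^sub>R B (?w s) = q s *\<^sub>R B (u s)" for s
      by (simp add: linear_diff[OF bounded_linear.linear[OF linear_B]] scaleR_diff_right)
    moreover have "S r u0 = S r (u0 - \<phi>) + \<phi>"
      using linear_diff[OF bounded_linear.linear[OF linear_S], of r u0 \<phi>] \<phi>(1)[of r] r by simp
    moreover have "u r = S r u0 - duhamel r (\<lambda>s. q s *\<^sub>R B (u s))"
      using u r unfolding trajectory_def by blast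
    ultimately show ?thesis by simp
  qed
  have bound: "norm (?w r) \<le> 2 * (z + \<beta> * ?I)" if r: "r \<in> {0..\<tau>}" for r
  proof (rule norm_le_if_absorbed[OF cont r])
    fix s M assume s: "s \<in> {0..\<tau>}" and M: "\<And>s. s \<in> {0..\<tau>} \<Longrightarrow> norm (?w s) \<le> M"
    have M0: "0 \<le> M" using M[OF s] norm_ge_zero order_trans by blast
    have "norm (duhamel s (\<lambda>s. q s *\<^sub>R B \<phi>)) \<le> \<beta> * ?I * 1"
      by (rule norm_duhamel_B_le[OF q(1) continuous_on_const _ s]) (simp add: \<phi>)
    moreover have "norm (duhamel s (\<lambda>s. q s *\<^sub>R B (?w s))) \<le> \<beta> * ?I * M"
      by (rule norm_duhamel_B_le[OF q(1) cont M s])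
    moreover have "\<beta> * ?I * M \<le> M / 2"
      using mult_right_mono[OF q(2) M0] by simp
    moreover have "norm (S s (u0 - \<phi>)) \<le> z"
      unfolding z_def by (rule contraction) (use s in simp)
    moreover have "norm (?w s) \<le> norm (S s (u0 - \<phi>)) + norm (duhamel s (\<lambda>s. q s *\<^sub>R B \<phi>)) +
        norm (duhamel s (\<lambda>s. q s *\<^sub>R B (?w s)))"
      unfolding w[OF s] by (meson add_mono norm_triangle_ineq4 order_refl order_trans)
    ultimately show "norm (?w s) \<le> z + \<beta> * ?I + M / 2" by simp
  qed
  have N0: "0 \<le> N" using cost(2) by simp
  have z0: "0 \<le> z" by (simp add: z_def)
  have I: "0 \<le> ?I" "?I \<le> N * z" using L1_norm_nonneg cost(1) by (auto simp: z_def)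
  have zN: "z \<le> N * z" using mult_right_mono[OF cost(2) z0] by simp
  have "norm (?w \<tau>) \<le> \<beta> * ?I * (2 * (z + \<beta> * ?I))"
    using w[of \<tau>] steer \<tau> norm_duhamel_B_le[OF q(1) cont bound, of \<tau>] by simp
  also have "\<dots> \<le> \<beta> * (N * z) * (2 * (N * z + \<beta> * (N * z)))"
    using I zN z0 N0 \<beta>_nonneg by (intro mult_mono add_mono mult_left_mono mult_nonneg_nonneg add_nonneg_nonneg) auto
  also have "\<dots> = 2 * \<beta> * (1 + \<beta>) * N\<^sup>2 * z\<^sup>2"
    by (simp add: power2_eq_square algebra_simps)
  finally show ?thesis by (simp add: z_def)
qed

end

section \<open>Steering to an equilibrium by Newton steps\<close>

lemma cauchy_schwarz_interval:
  fixes p :: "real \<Rightarrow> real"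
  assumes ab: "a < b" and meas: "set_borel_measurable lborel {a..b} p"
    and sq: "set_integrable lborel {a..b} (\<lambda>s. (p s)\<^sup>2)"
  shows "set_integrable lborel {a..b} p"
    and "(LINT s:{a..b}|lborel. \<bar>p s\<bar>)\<^sup>2 \<le> (b - a) * (LINT s:{a..b}|lborel. (p s)\<^sup>2)"
proof -
  have const: "set_integrable lborel {a..b} (\<lambda>s. c)" for c :: real
    using integrable_real_indicator[of "{a..b}" lborel] ab
    unfolding set_integrable_def by simp
  have "\<bar>x\<bar> \<le> 1 + x\<^sup>2" for x :: real
    using zero_le_power2[of "\<bar>x\<bar> - 1"] by (simp add: power2_diff) 
  then show p: "set_integrable lborel {a..b} p"
    by (intro set_integrable_bound[OF set_integral_add(1)[OF const[of 1] sq] meas]) auto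
  define m where "m = (LINT s:{a..b}|lborel. \<bar>p s\<bar>)"
  \<comment> \<open>Integrate \<open>0 \<le> (\<bar>p s\<bar> - k)\<^sup>2\<close>, where \<open>k\<close> is the mean of \<open>\<bar>p\<bar>\<close>.\<close>
  define k where "k = m / (b - a)"
  have "2 * k * \<bar>x\<bar> \<le> x\<^sup>2 + k\<^sup>2" for x
    using zero_le_power2[of "\<bar>x\<bar> - k"] by (simp add: power2_diff algebra_simps)
  then have "(LINT s:{a..b}|lborel. 2 * k * \<bar>p s\<bar>) \<le> (LINT s:{a..b}|lborel. (p s)\<^sup>2 + k\<^sup>2)"
    using set_integrable_abs[OF p] set_integral_add(1)[OF sq const] by (intro set_integral_mono) auto
  also have "\<dots> = (LINT s:{a..b}|lborel. (p s)\<^sup>2) + (LINT s:{a..b}|lborel. k\<^sup>2)"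
    by (rule set_integral_add(2)[OF sq const])
  also have "(LINT s:{a..b}|lborel. k\<^sup>2) = (b - a) * k\<^sup>2"
    using ab by (simp add: set_integral_const)
  finally have "2 * k * m \<le> (LINT s:{a..b}|lborel. (p s)\<^sup>2) + (b - a) * k\<^sup>2"
    by (simp add: m_def)
  then have "(b - a) * (2 * k * m) \<le> (b - a) * ((LINT s:{a..b}|lborel. (p s)\<^sup>2) + (b - a) * k\<^sup>2)"
    using ab by (intro mult_left_mono) auto
  moreover have dk: "(b - a) * k = m" using ab by (simp add: k_def)
  have "(b - a) * (2 * k * m) = 2 * ((b - a) * k) * m" "(b - a) * ((b - a) * k\<^sup>2) = ((b - a) * k)\<^sup>2"
    by (simp_all add: power2_eq_square mult_ac)
  then have "(b - a) * (2 * k * m) = 2 * m\<^sup>2" "(b - a) * ((b - a) * k\<^sup>2) = m\<^sup>2"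
    unfolding dk by (simp_all add: power2_eq_square)
  ultimately show "(LINT s:{a..b}|lborel. \<bar>p s\<bar>)\<^sup>2 \<le> (b - a) * (LINT s:{a..b}|lborel. (p s)\<^sup>2)"
    by (simp add: m_def[symmetric] distrib_left)
qed

text \<open>
  Step \<open>n\<close> takes place on \<open>[t n, t (Suc n)]\<close>, has cost \<open>N n\<close> and starts at distance at most \<open>\<epsilon> n\<close>
  from the equilibrium. \<open>quadratic\<close> is the passage of the bound \<open>\<epsilon>\<close> through \<open>newton_step\<close>.
  \<open>energy\<close> keeps the total control so small that trajectories exist on all of \<open>[0, T]\<close>; since the
  controls act on \<open>[t 0, T]\<close> only, \<open>short\<close> makes this condition independent of the time \<open>t 0\<close> at
  which the first step begins.
\<close>

locale newton_scheme = bilinear_system S B \<beta>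
  for S :: "real \<Rightarrow> 'a::{banach, second_countable_topology} \<Rightarrow> 'a" and B \<beta> +
  fixes \<phi> :: 'a and t :: "nat \<Rightarrow> real" and T :: real and N \<epsilon> :: "nat \<Rightarrow> real"
  assumes equilibrium: "0 \<le> r \<Longrightarrow> S r \<phi> = \<phi>" and norm_\<phi>: "norm \<phi> = 1"
    and t_0: "0 \<le> t 0" and t_Suc: "t n < t (Suc n)" and t_lim: "t \<longlonglongrightarrow> T" and short: "T - t 0 \<le> 1"
    and null_control: "\<exists>q\<in>L2 (t (Suc n) - t n). L2_norm (t (Suc n) - t n) q \<le> N n * norm z \<and>
        S (t (Suc n) - t n) z = duhamel (t (Suc n) - t n) (\<lambda>s. q s *\<^sub>R B \<phi>)"
    and N_ge_1: "1 \<le> N n" and \<epsilon>_lim: "\<epsilon> \<longlonglongrightarrow> 0"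
    and quadratic: "2 * \<beta> * (1 + \<beta>) * (N n)\<^sup>2 * (\<epsilon> n)\<^sup>2 \<le> \<epsilon> (Suc n)"
    and energy: "4 * \<beta>\<^sup>2 * (\<Sum>k<n. (N k * \<epsilon> k)\<^sup>2) \<le> 1"
begin

lemma t_strict_mono: "strict_mono t"
  using t_Suc by (rule strict_mono_Suc_iff[THEN iffD2, rule_format])

lemma t_less_T: "t n < T"
  using incseq_le[OF strict_mono_mono[OF t_strict_mono] t_lim, of "Suc n"] t_Suc[of n] by simp

lemma t_ge_0: "0 \<le> t n"
  using t_0 strict_mono_less_eq[OF t_strict_mono, of 0 n] by simp

definition admissible :: "real \<Rightarrow> (real \<Rightarrow> real) \<Rightarrow> bool" where
  "admissible b p \<longleftrightarrow> p \<in> borel_measurable borel \<and> (\<forall>s. s \<notin> {t 0..<b} \<longrightarrow> p s = 0) \<and>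
     integrable lborel (\<lambda>s. (p s)\<^sup>2) \<and> 4 * \<beta>\<^sup>2 * (LINT s|lborel. (p s)\<^sup>2) \<le> 1"

text \<open>
  By Cauchy--Schwarz on \<open>[t 0, T]\<close>, an interval of length at most \<open>1\<close>, the energy bound in
  \<open>admissible\<close> is what \<open>trajectory_exists\<close> and \<open>trajectory_unique\<close> require.
\<close>

lemma admissible_bounds:
  assumes p: "admissible b p" and b: "b \<le> T"
  shows "p \<in> L2 T" and "set_integrable lborel {0..T} p" and "\<beta> * L1_norm T p \<le> 1 / 2"
proof -
  have [measurable]: "p \<in> borel_measurable borel" and sq: "integrable lborel (\<lambda>s. (p s)\<^sup>2)"
    and supp: "\<And>s. s \<notin> {t 0..<b} \<Longrightarrow> p s = 0"
    and small: "4 * \<beta>\<^sup>2 * (LINT s|lborel. (p s)\<^sup>2) \<le> 1"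
    using p unfolding admissible_def by auto
  have sq': "set_integrable lborel A (\<lambda>s. (p s)\<^sup>2)" if "A \<in> sets borel" for A
    unfolding set_integrable_def using integrable_mult_indicator[OF _ sq] that by simp
  show "p \<in> L2 T"
    unfolding L2_def set_borel_measurable_def using sq' by simp
  have meas: "set_borel_measurable lborel {a..b} p" for a b
    unfolding set_borel_measurable_def by simp
  show "set_integrable lborel {0..T} p"
    by (rule cauchy_schwarz_interval(1)[OF le_less_trans[OF t_0 t_less_T] meas sq']) simp
  let ?m = "LINT s:{t 0..T}|lborel. \<bar>p s\<bar>"
  have "indicator {0..T} s *\<^sub>R \<bar>p s\<bar> = indicator {t 0..T} s *\<^sub>R \<bar>p s\<bar>" for s
    using supp[of s] t_0 by (auto simp: indicator_def)
  then have m: "L1_norm T p = ?m"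
    unfolding L1_norm_def set_lebesgue_integral_def by (simp only:)
  have "indicator {t 0..T} s *\<^sub>R (p s)\<^sup>2 = (p s)\<^sup>2" for s
    using supp[of s] b by (cases "s \<in> {t 0..<b}") (auto simp: indicator_def)
  then have eq: "(LINT s:{t 0..T}|lborel. (p s)\<^sup>2) = (LINT s|lborel. (p s)\<^sup>2)"
    unfolding set_lebesgue_integral_def by (simp only:)
  have "?m\<^sup>2 \<le> (T - t 0) * (LINT s|lborel. (p s)\<^sup>2)"
    using cauchy_schwarz_interval(2)[OF t_less_T[of 0] meas sq'] unfolding eq by simp
  also have "\<dots> \<le> 1 * (LINT s|lborel. (p s)\<^sup>2)"
    using short by (intro mult_right_mono) (auto intro: Bochner_Integration.integral_nonneg)
  finally have "\<beta>\<^sup>2 * ?m\<^sup>2 \<le> \<beta>\<^sup>2 * (LINT s|lborel. (p s)\<^sup>2)"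
    by (intro mult_left_mono) auto
  then have "(2 * \<beta> * ?m)\<^sup>2 \<le> 1\<^sup>2"
    using small by (simp add: power_mult_distrib)
  then show "\<beta> * L1_norm T p \<le> 1 / 2"
    unfolding m using power2_le_imp_le[of "2 * \<beta> * ?m" 1] by simp
qed

text \<open>
  The state of the iteration is a control that is already fixed before \<open>t n\<close> and vanishes
  afterwards. Later steps do not change the trajectory up to \<open>t n\<close>, so the controls can be
  pasted together and the distance to \<open>\<phi>\<close> at time \<open>t n\<close> remains at most \<open>\<epsilon> n\<close>.
\<close>

definition stage :: "'a \<Rightarrow> nat \<Rightarrow> (real \<Rightarrow> real) \<Rightarrow> bool" where
  "stage u0 n p \<longleftrightarrow> p \<in> borel_measurable borel \<and> (\<forall>s. s \<notin> {t 0..<t n} \<longrightarrow> p s = 0) \<and>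
     integrable lborel (\<lambda>s. (p s)\<^sup>2) \<and> (LINT s|lborel. (p s)\<^sup>2) \<le> (\<Sum>k<n. (N k * \<epsilon> k)\<^sup>2) \<and>
     (\<exists>u. trajectory T u0 p u \<and> norm (u (t n) - \<phi>) \<le> \<epsilon> n)"

lemma stage_admissible: "stage u0 n p \<Longrightarrow> admissible (t n) p"
  unfolding stage_def admissible_def
  using energy[of n] mult_left_mono[of "LINT s|lborel. (p s)\<^sup>2" "\<Sum>k<n. (N k * \<epsilon> k)\<^sup>2" "4 * \<beta>\<^sup>2"]
  by force

text \<open>
  The new control is the old one plus a null control for the current error \<open>u (t n) - \<phi>\<close>, moved
  to \<open>[t n, t (Suc n)[\<close>. By uniqueness the new trajectory passes through \<open>u (t n)\<close>, from where it
  makes a Newton step.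
\<close>

lemma stage_Suc:
  assumes p: "stage u0 n p"
  shows "\<exists>p'. stage u0 (Suc n) p' \<and> (\<forall>s<t n. p' s = p s)"
proof -
  let ?\<tau> = "t (Suc n) - t n"
  have [measurable]: "p \<in> borel_measurable borel" and p2: "integrable lborel (\<lambda>s. (p s)\<^sup>2)"
    and supp: "\<And>s. s \<notin> {t 0..<t n} \<Longrightarrow> p s = 0"
    and p_le: "(LINT s|lborel. (p s)\<^sup>2) \<le> (\<Sum>k<n. (N k * \<epsilon> k)\<^sup>2)"
    using p unfolding stage_def by auto
  obtain u where u: "trajectory T u0 p u" and ue: "norm (u (t n) - \<phi>) \<le> \<epsilon> n"
    using p unfolding stage_def by blast
  obtain q where q: "q \<in> L2 ?\<tau>" and q_norm: "L2_norm ?\<tau> q \<le> N n * norm (u (t n) - \<phi>)"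
    and steer: "S ?\<tau> (u (t n) - \<phi>) = duhamel ?\<tau> (\<lambda>s. q s *\<^sub>R B \<phi>)"
    using null_control by blast
  have \<tau>: "0 < ?\<tau>" "?\<tau> \<le> 1"
    using t_Suc[of n] t_less_T[of "Suc n"] short strict_mono_less_eq[OF t_strict_mono, of 0 n] by auto
  \<comment> \<open>The half-open interval keeps the supports of \<open>p\<close> and the moved \<open>q'\<close> disjoint, so that
    energies add up.\<close>
  define q' where "q' s = indicator {0..<?\<tau>} s * q s" for s
  define p' where "p' s = p s + q' (s - t n)" for s
  have q'_eq: "q' s = indicator {0..<?\<tau>} s * (indicator {0..?\<tau>} s *\<^sub>R q s)" for s
    by (auto simp: q'_def indicator_def)
  have "(\<lambda>s. indicator {0..?\<tau>} s *\<^sub>R q s) \<in> borel_measurable borel"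
    using q unfolding L2_def set_borel_measurable_def by simp
  then have [measurable]: "q' \<in> borel_measurable borel"
    unfolding q'_eq[abs_def] by measurable
  have Q: "set_borel_measurable lborel {0..?\<tau>} q" "set_integrable lborel {0..?\<tau>} (\<lambda>s. (q s)\<^sup>2)"
    using q unfolding L2_def by auto
  have q2: "integrable lborel (\<lambda>s. (q' s)\<^sup>2)" "(LINT s|lborel. (q' s)\<^sup>2) = (LINT s:{0..?\<tau>}|lborel. (q s)\<^sup>2)"
  proof -
    let ?f = "\<lambda>s. indicator {0..?\<tau>} s *\<^sub>R (q s)\<^sup>2"
    have f: "integrable lborel ?f" using Q(2) unfolding set_integrable_def .
    have AE: "AE s in lborel. ?f s = (q' s)\<^sup>2"
      using AE_lborel_singleton[of ?\<tau>] by eventually_elim (auto simp: q'_def indicator_def)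
    show "integrable lborel (\<lambda>s. (q' s)\<^sup>2)"
      by (rule integrable_cong_AE_imp[OF f _ AE]) measurable
    show "(LINT s|lborel. (q' s)\<^sup>2) = (LINT s:{0..?\<tau>}|lborel. (q s)\<^sup>2)"
      unfolding set_lebesgue_integral_def
      by (rule integral_cong_AE[symmetric, OF borel_measurable_integrable[OF f] _ AE]) measurable
  qed
  have q_le: "L2_norm ?\<tau> q \<le> N n * \<epsilon> n"
    using order_trans[OF q_norm mult_left_mono[OF ue]] N_ge_1[of n] by simp
  then have q_energy: "(LINT s:{0..?\<tau>}|lborel. (q s)\<^sup>2) \<le> (N n * \<epsilon> n)\<^sup>2"
    unfolding L2_norm_def by (rule sqrt_le_D)
  have shift: "integrable lborel (\<lambda>s. (q' (s - t n))\<^sup>2)"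
    "(LINT s|lborel. (q' (s - t n))\<^sup>2) = (LINT s|lborel. (q' s)\<^sup>2)"
    using lborel_integrable_real_affine[OF q2(1), of 1 "- t n"]
      lborel_integral_real_affine[of 1 "\<lambda>s. (q' s)\<^sup>2" "- t n"] by simp_all
  have sq: "(p' s)\<^sup>2 = (p s)\<^sup>2 + (q' (s - t n))\<^sup>2" for s
    using supp[of s] by (cases "s < t n") (auto simp: p'_def q'_def)
  have p'_int: "integrable lborel (\<lambda>s. (p' s)\<^sup>2)"
    "(LINT s|lborel. (p' s)\<^sup>2) \<le> (\<Sum>k<Suc n. (N k * \<epsilon> k)\<^sup>2)"
    unfolding sq using p2 shift p_le q2(2) q_energy by auto
  have p'_meas: "p' \<in> borel_measurable borel" unfolding p'_def[abs_def] by measurable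
  have p'_supp: "p' s = 0" if "s \<notin> {t 0..<t (Suc n)}" for s
    using supp[of s] that t_Suc[of n] strict_mono_less_eq[OF t_strict_mono, of 0 n]
    by (auto simp: p'_def q'_def indicator_def)
  have p'_before: "p' s = p s" if "s < t n" for s
    using that by (simp add: p'_def q'_def)
  have p'_after: "p' (t n + s) = q s" if "s \<in> {0..<?\<tau>}" for s
    using that supp[of "t n + s"] by (simp add: p'_def q'_def)
  have "4 * \<beta>\<^sup>2 * (LINT s|lborel. (p' s)\<^sup>2) \<le> 1"
    using energy[of "Suc n"] mult_left_mono[OF p'_int(2), of "4 * \<beta>\<^sup>2"] by simp
  then have adm: "admissible (t (Suc n)) p'"
    unfolding admissible_def using p'_meas p'_supp p'_int(1) by blast
  note L1_norm' = admissible_bounds[OF adm less_imp_le[OF t_less_T]]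
  obtain u' where u': "trajectory T u0 p' u'"
    using trajectory_exists[OF _ L1_norm'(2,3)] t_less_T[of 0] t_0 by fastforce
  have tn: "0 \<le> t n" "t n \<le> T" "t (Suc n) \<le> T"
    using t_ge_0[of n] t_less_T[of n] t_less_T[of "Suc n"] by auto
  have "u' (t n) = u (t n)"
  proof (rule trajectory_unique)
    show "trajectory (t n) u0 p' u'" by (rule trajectory_shorten[OF u' tn(2)])
    show "trajectory (t n) u0 p' u"
      by (rule trajectory_cong[OF trajectory_shorten[OF u tn(2)]]) (simp add: p'_before)
    show "set_integrable lborel {0..t n} p'" by (rule set_integrable_subinterval[OF L1_norm'(2) tn(2)])
    show "\<beta> * L1_norm (t n) p' \<le> 1 / 2"
      using mult_left_mono[OF L1_norm_mono[OF L1_norm'(2) tn(2)] \<beta>_nonneg] L1_norm'(3) by simp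
  qed (use tn in simp)
  with trajectory_restart[OF u' L1_norm'(2) tn(1), of ?\<tau>] \<tau> tn
  have "trajectory ?\<tau> (u (t n)) (\<lambda>s. p' (t n + s)) (\<lambda>s. u' (t n + s))" by simp
  then have traj: "trajectory ?\<tau> (u (t n)) q (\<lambda>s. u' (t n + s))"
    by (rule trajectory_cong) (rule p'_after)
  note cs = cauchy_schwarz_interval[OF \<tau>(1) Q]
  have L1_norm_q: "L1_norm ?\<tau> q \<le> L2_norm ?\<tau> q"
  proof -
    have "0 \<le> (LINT s:{0..?\<tau>}|lborel. (q s)\<^sup>2)"
      unfolding set_lebesgue_integral_def by (rule Bochner_Integration.integral_nonneg) simp
    then have "(?\<tau> - 0) * (LINT s:{0..?\<tau>}|lborel. (q s)\<^sup>2) \<le> 1 * (LINT s:{0..?\<tau>}|lborel. (q s)\<^sup>2)"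
      by (rule mult_right_mono[rotated]) (use \<tau>(2) in simp)
    then have "(L1_norm ?\<tau> q)\<^sup>2 \<le> 1 * (LINT s:{0..?\<tau>}|lborel. (q s)\<^sup>2)"
      unfolding L1_norm_def by (rule order_trans[OF cs(2)])
    then show ?thesis unfolding L2_norm_def by (intro real_le_rsqrt) simp
  qed
  have "(L1_norm ?\<tau> q)\<^sup>2 \<le> (N n * \<epsilon> n)\<^sup>2"
    by (rule power_mono[OF order_trans[OF L1_norm_q q_le] L1_norm_nonneg])
  also have "\<dots> \<le> (\<Sum>k<Suc n. (N k * \<epsilon> k)\<^sup>2)"
    by (simp add: sum_nonneg)
  finally have "4 * \<beta>\<^sup>2 * (L1_norm ?\<tau> q)\<^sup>2 \<le> 4 * \<beta>\<^sup>2 * (\<Sum>k<Suc n. (N k * \<epsilon> k)\<^sup>2)"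
    by (rule mult_left_mono) simp
  also note energy[of "Suc n"]
  finally have "(2 * \<beta> * L1_norm ?\<tau> q)\<^sup>2 \<le> 1\<^sup>2"
    by (simp add: power_mult_distrib)
  then have "2 * \<beta> * L1_norm ?\<tau> q \<le> 1"
    by (rule power2_le_imp_le) simp
  then have "\<beta> * L1_norm ?\<tau> q \<le> 1 / 2" by simp
  then have "norm (u' (t n + ?\<tau>) - \<phi>) \<le> 2 * \<beta> * (1 + \<beta>) * (N n)\<^sup>2 * (norm (u (t n) - \<phi>))\<^sup>2"
    by (rule newton_step[OF traj cs(1) _ equilibrium norm_\<phi> less_imp_le[OF \<tau>(1)] steer
        order_trans[OF L1_norm_q q_norm] N_ge_1])
  also have "\<dots> \<le> 2 * \<beta> * (1 + \<beta>) * (N n)\<^sup>2 * (\<epsilon> n)\<^sup>2"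
    using ue \<beta>_nonneg by (intro mult_left_mono power_mono) auto
  also have "\<dots> \<le> \<epsilon> (Suc n)" by (rule quadratic)
  finally have "norm (u' (t (Suc n)) - \<phi>) \<le> \<epsilon> (Suc n)" by simp
  then have "stage u0 (Suc n) p'"
    unfolding stage_def using p'_meas p'_supp p'_int u' by blast
  then show ?thesis using p'_before by blast
qed

text \<open>
  The controls of the stages stabilise pointwise; their limit \<open>p\<close> has a trajectory \<open>u\<close> on all of
  \<open>[0, T]\<close> that agrees with the \<open>n\<close>-th one at time \<open>t n\<close>. Continuity of \<open>u\<close> at \<open>T\<close> gives \<open>u T = \<phi>\<close>.
\<close>

lemma exact_control:
  assumes start: "norm (S (t 0) u0 - \<phi>) \<le> \<epsilon> 0"
  shows "\<exists>p\<in>L2 T. \<exists>u. trajectory T u0 p u \<and> u T = \<phi>"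
proof -
  have T0: "0 \<le> T" using t_less_T[of 0] t_0 by simp
  have "duhamel r (\<lambda>_. 0) = 0" for r
    using norm_duhamel_le[of r "\<lambda>_. 0"] by (simp add: set_integrable_def)
  then have "trajectory T u0 (\<lambda>_. 0) (\<lambda>r. S r u0)"
    unfolding trajectory_def
    by (intro conjI ballI continuous_on_subset[OF continuous_on_orbit]) (simp_all add: subset_iff)
  with start have stage0: "stage u0 0 (\<lambda>_. 0)"
    unfolding stage_def by auto
  have "\<exists>P. \<forall>n. stage u0 n (P n) \<and> (\<forall>s<t n. P (Suc n) s = P n s)"
    by (rule dependent_nat_choice[OF exI[of "stage u0 0", OF stage0] stage_Suc])
  then obtain P where P: "\<And>n. stage u0 n (P n)" "\<And>n s. s < t n \<Longrightarrow> P (Suc n) s = P n s"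
    by blast
  have stable: "P (n + k) s = P n s" if "s < t n" for n k s
  proof (induction k)
    case (Suc k)
    have "s < t (n + k)"
      using that strict_mono_less_eq[OF t_strict_mono, of n "n + k"] by simp
    then show ?case using P(2) Suc by simp
  qed simp
  have supp: "P n s = 0" if "s \<notin> {t 0..<t n}" for n s
    using P(1)[of n] that unfolding stage_def by blast
  have [measurable]: "P n \<in> borel_measurable borel" for n
    using P(1)[of n] unfolding stage_def by blast
  define p where "p s = lim (\<lambda>n. P n s)" for s
  have p_eq: "p s = P n s" if "s < t n" for n s
  proof -
    have "(\<lambda>k. P k s) \<longlonglongrightarrow> P n s"
      by (rule tendsto_eventually, rule eventually_sequentiallyI[of n]) (metis le_Suc_ex stable that)
    then show ?thesis unfolding p_def by (rule limI)
  qed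
  have p_lim: "(\<lambda>n. P n s) \<longlonglongrightarrow> p s" and p_supp: "s \<notin> {t 0..<T} \<Longrightarrow> p s = 0" for s
  proof -
    show "(\<lambda>n. P n s) \<longlonglongrightarrow> p s"
    proof (cases "s < T")
      case True
      then obtain n where n: "s < t n"
        using order_tendstoD(1)[OF t_lim True] by (auto simp: eventually_sequentially)
      show ?thesis
        unfolding p_eq[OF n]
        by (rule tendsto_eventually, rule eventually_sequentiallyI[of n]) (metis le_Suc_ex stable n)
    next
      case False
      then have "P n s = 0" for n using supp[of s n] t_less_T[of n] by simp
      then show ?thesis by (simp add: p_def)
    qed
    assume "s \<notin> {t 0..<T}"
    then have "P n s = 0" for n using supp[of s n] t_less_T[of n] by auto
    then show "p s = 0" by (simp add: p_def)
  qed
  have p_meas: "p \<in> borel_measurable borel"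
    by (rule borel_measurable_LIMSEQ_real[OF p_lim]) simp
  have mono: "(P n s)\<^sup>2 \<le> (P (Suc n) s)\<^sup>2" for n s
    using P(2)[of s n] supp[of s n] by (cases "s < t n") auto
  have P_int: "integrable lborel (\<lambda>s. (P n s)\<^sup>2)" for n
    using P(1)[of n] unfolding stage_def by blast
  have adm: "admissible (t n) (P n)" for n
    by (rule stage_admissible[OF P(1)])
  let ?E = "\<lambda>n. LINT s|lborel. (P n s)\<^sup>2"
  have E_le: "?E n \<le> 1 / (4 * \<beta>\<^sup>2)" for n
    using adm[of n] \<beta>_pos unfolding admissible_def by (simp add: field_simps)
  have "incseq ?E"
    by (intro incseq_SucI integral_mono P_int mono)
  then obtain L where L: "?E \<longlonglongrightarrow> L"
    by (rule incseq_convergent) (rule allI[OF E_le])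
  then have "L \<le> 1 / (4 * \<beta>\<^sup>2)"
    by (rule LIMSEQ_le_const2) (use E_le in blast)
  moreover have "integrable lborel (\<lambda>s. (p s)\<^sup>2)" "(LINT s|lborel. (p s)\<^sup>2) = L"
  proof -
    have "mono (\<lambda>n. (P n s)\<^sup>2)" for s
      by (rule incseq_SucI) (rule mono)
    moreover have "(\<lambda>n. (P n s)\<^sup>2) \<longlonglongrightarrow> (p s)\<^sup>2" for s
      by (intro tendsto_power p_lim)
    moreover have "(\<lambda>s. (p s)\<^sup>2) \<in> borel_measurable lborel"
      using p_meas by measurable
    ultimately show "integrable lborel (\<lambda>s. (p s)\<^sup>2)" "(LINT s|lborel. (p s)\<^sup>2) = L"
      by (intro integral_monotone_convergence_nonneg[OF P_int _ _ _ L]; simp)+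
  qed
  ultimately have "integrable lborel (\<lambda>s. (p s)\<^sup>2)" "4 * \<beta>\<^sup>2 * (LINT s|lborel. (p s)\<^sup>2) \<le> 1"
    using \<beta>_pos by (auto simp: field_simps)
  then have p_adm: "admissible T p"
    unfolding admissible_def using p_meas p_supp by blast
  note L1_norm = admissible_bounds[OF p_adm order_refl]
  obtain u where u: "trajectory T u0 p u"
    using trajectory_exists[OF T0 L1_norm(2,3)] by blast
  have near: "norm (u (t n) - \<phi>) \<le> \<epsilon> n" for n
  proof -
    obtain v where v: "trajectory T u0 (P n) v" "norm (v (t n) - \<phi>) \<le> \<epsilon> n"
      using P(1)[of n] unfolding stage_def by blast
    have tn: "0 \<le> t n" "t n \<le> T" using t_ge_0 t_less_T[of n] by auto
    have "u (t n) = v (t n)"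
    proof (rule trajectory_unique)
      show "trajectory (t n) u0 p u" by (rule trajectory_shorten[OF u tn(2)])
      show "trajectory (t n) u0 p v"
        by (rule trajectory_cong[OF trajectory_shorten[OF v(1) tn(2)]]) (rule p_eq[symmetric], simp)
      show "set_integrable lborel {0..t n} p" by (rule set_integrable_subinterval[OF L1_norm(2) tn(2)])
      show "\<beta> * L1_norm (t n) p \<le> 1 / 2"
        using mult_left_mono[OF L1_norm_mono[OF L1_norm(2) tn(2)] \<beta>_nonneg] L1_norm(3) by simp
    qed (use tn in simp)
    with v show ?thesis by simp
  qed
  have "t n \<in> {0..T}" for n
    using t_ge_0[of n] t_less_T[of n] by simp
  then have "(\<lambda>n. u (t n)) \<longlonglongrightarrow> u T"
    using continuous_on_tendsto_compose[of "{0..T}" u, OF _ t_lim] u T0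
    unfolding trajectory_def by simp
  moreover have "(\<lambda>n. u (t n)) \<longlonglongrightarrow> \<phi>"
    by (rule LIM_zero_cancel, rule Lim_null_comparison[OF _ \<epsilon>_lim]) (simp add: near)
  ultimately have "u T = \<phi>" by (rule LIMSEQ_unique)
  then show ?thesis using u L1_norm(1) by blast
qed

end

context bilinear_system
begin

text \<open>
  Steps of length \<open>\<tau> / \<rho> n\<close> with \<open>\<rho> n = (3/2)^n\<close> cost \<open>N n = C exp (\<nu> \<rho> n / \<tau>)\<close>. The
  distances may be taken to be \<open>exp (- a \<rho> n)\<close>: squaring doubles the exponent, of which only
  \<open>3/2\<close> is needed for the next step, and the remaining half of \<open>a \<rho> n\<close> pays for the factor
  \<open>(N n)\<^sup>2\<close>.
\<close>

lemma local_exact_control: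
  assumes equilibrium: "\<And>r. 0 \<le> r \<Longrightarrow> S r \<phi> = \<phi>" and norm_\<phi>: "norm \<phi> = 1"
    and pos: "1 \<le> C" "0 < \<nu>" "0 < T0"
    and null_control: "\<And>\<tau> z. 0 < \<tau> \<Longrightarrow> \<tau> \<le> T0 \<Longrightarrow>
      \<exists>q\<in>L2 \<tau>. L2_norm \<tau> q \<le> C * exp (\<nu> / \<tau>) * norm z \<and> S \<tau> z = duhamel \<tau> (\<lambda>s. q s *\<^sub>R B \<phi>)"
  shows "\<exists>\<delta>>0. \<exists>T>0. \<forall>t1\<ge>0. \<forall>u0. norm (S t1 u0 - \<phi>) \<le> \<delta> \<longrightarrow>
    (\<exists>p\<in>L2 (t1 + T). \<exists>u. trajectory (t1 + T) u0 p u \<and> u (t1 + T) = \<phi>)"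
proof -
  define \<tau> where "\<tau> = min T0 (1 / 3)"
  define K where "K = 2 * \<beta> * (1 + \<beta>)"
  \<comment> \<open>\<open>exp L\<close> beats the constants in the conditions \<open>quadratic\<close> and \<open>energy\<close>; \<open>a\<close> solves
    \<open>L + 2 \<nu> / \<tau> - 2 a = - 3 a / 2\<close>, the relation that \<open>quadratic\<close> needs.\<close>
  define L where "L = 1 + K * C\<^sup>2 + 8 * C\<^sup>2 * \<beta>\<^sup>2"
  define a where "a = 4 * \<nu> / \<tau> + 2 * L"
  define \<rho> :: "nat \<Rightarrow> real" where "\<rho> n = (3 / 2) ^ n" for n
  define \<epsilon> where "\<epsilon> n = exp (- a * \<rho> n)" for n
  define N where "N n = C * exp (\<nu> * \<rho> n / \<tau>)" for n
  have \<tau>: "0 < \<tau>" "\<tau> \<le> T0" "3 * \<tau> \<le> 1" using pos by (auto simp: \<tau>_def)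
  have K: "0 \<le> K" using \<beta>_nonneg by (simp add: K_def)
  have L: "1 \<le> L" "K * C\<^sup>2 \<le> exp L" "8 * C\<^sup>2 * \<beta>\<^sup>2 \<le> exp L"
  proof -
    have "0 \<le> K * C\<^sup>2" "0 \<le> 8 * C\<^sup>2 * \<beta>\<^sup>2" using K by auto
    then show "1 \<le> L" "K * C\<^sup>2 \<le> exp L" "8 * C\<^sup>2 * \<beta>\<^sup>2 \<le> exp L"
      using exp_ge_add_one_self[of L] unfolding L_def by linarith+
  qed
  have a: "0 < a" using L(1) pos \<tau>(1) by (simp add: a_def add_pos_pos)
  have \<rho>_pos: "0 < \<rho> n" for n by (simp add: \<rho>_def)
  have \<rho>_ge: "1 + real n / 2 \<le> \<rho> n" for n
    using Bernoulli_inequality[of "1/2" n] by (simp add: \<rho>_def)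
  \<comment> \<open>The steps \<open>\<tau> (2/3)\<^sup>n\<close> add up to \<open>3 \<tau>\<close>.\<close>
  have scheme: "newton_scheme S B \<beta> \<phi> (\<lambda>n. t1 + 3 * \<tau> * (1 - (2 / 3) ^ n)) (t1 + 3 * \<tau>) N \<epsilon>"
    if t1: "0 \<le> t1" for t1
  proof (unfold_locales)
    let ?t = "\<lambda>n. t1 + 3 * \<tau> * (1 - (2 / 3) ^ n)"
    have step: "?t (Suc n) - ?t n = \<tau> / \<rho> n" for n
      by (simp add: \<rho>_def field_simps)
    show "S r \<phi> = \<phi>" if "0 \<le> r" for r by (rule equilibrium[OF that])
    show "norm \<phi> = 1" by (rule norm_\<phi>)
    show "0 \<le> ?t 0" using t1 by simp
    show "?t n < ?t (Suc n)" for n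
      using step[of n] \<tau>(1) \<rho>_pos[of n] by (smt (verit) divide_pos_pos)
    have "?t \<longlonglongrightarrow> t1 + 3 * \<tau> * (1 - 0)"
      by (intro tendsto_intros LIMSEQ_realpow_zero) auto
    then show "?t \<longlonglongrightarrow> t1 + 3 * \<tau>" by simp
    show "t1 + 3 * \<tau> - ?t 0 \<le> 1" using \<tau> by simp
    show "\<exists>q\<in>L2 (?t (Suc n) - ?t n). L2_norm (?t (Suc n) - ?t n) q \<le> N n * norm z \<and>
        S (?t (Suc n) - ?t n) z = duhamel (?t (Suc n) - ?t n) (\<lambda>s. q s *\<^sub>R B \<phi>)" for n z
    proof -
      have "\<tau> / \<rho> n \<le> \<tau>"
        using \<rho>_ge[of n] \<rho>_pos[of n] \<tau>(1) by (simp add: divide_le_eq)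
      then show ?thesis
        unfolding step using null_control[of "\<tau> / \<rho> n" z] \<tau> \<rho>_pos[of n] by (simp add: N_def)
    qed
    show "1 \<le> N n" for n
      unfolding N_def using pos \<tau> \<rho>_pos[of n] mult_mono[of 1 C 1 "exp (\<nu> * \<rho> n / \<tau>)"] by simp
    show "\<epsilon> \<longlonglongrightarrow> 0"
    proof -
      have "filterlim \<rho> at_top sequentially"
      proof (rule filterlim_at_top_mono)
        show "filterlim (\<lambda>n. 1 / 2 * real n) at_top sequentially"
          by (rule filterlim_tendsto_pos_mult_at_top[OF tendsto_const _ filterlim_real_sequentially]) simp
        have "1 / 2 * real n \<le> \<rho> n" for n using \<rho>_ge[of n] by simp
        then show "\<forall>\<^sub>F n in sequentially. 1 / 2 * real n \<le> \<rho> n" by simp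
      qed
      then have "filterlim (\<lambda>n. a * \<rho> n) at_top sequentially"
        by (rule filterlim_tendsto_pos_mult_at_top[OF tendsto_const a])
      then have "filterlim (\<lambda>n. - a * \<rho> n) at_bot sequentially"
        by (simp add: filterlim_uminus_at_bot)
      then show ?thesis
        unfolding \<epsilon>_def by (rule filterlim_compose[OF exp_at_bot])
    qed
    show "2 * \<beta> * (1 + \<beta>) * (N n)\<^sup>2 * (\<epsilon> n)\<^sup>2 \<le> \<epsilon> (Suc n)" for n
    proof -
      have "2 * \<beta> * (1 + \<beta>) * (N n)\<^sup>2 * (\<epsilon> n)\<^sup>2 = (K * C\<^sup>2) * exp (2 * (\<nu> * \<rho> n / \<tau>) - 2 * (a * \<rho> n))"
        by (simp add: K_def N_def \<epsilon>_def power_mult_distrib exp_diff exp_minus field_simps flip: exp_double)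
      also have "\<dots> \<le> exp (L * \<rho> n) * exp (2 * (\<nu> * \<rho> n / \<tau>) - 2 * (a * \<rho> n))"
      proof (rule mult_right_mono)
        have "L * 1 \<le> L * \<rho> n"
          using L(1) \<rho>_ge[of n] by (intro mult_left_mono) auto
        then show "K * C\<^sup>2 \<le> exp (L * \<rho> n)"
          using L(2) by (simp add: order_trans[OF _ exp_le_cancel_iff[THEN iffD2]])
      qed simp
      also have "\<dots> = exp (- a * (3 / 2 * \<rho> n))"
        unfolding exp_add[symmetric] by (simp add: a_def field_simps)
      finally show ?thesis by (simp add: \<epsilon>_def \<rho>_def)
    qed
    show "4 * \<beta>\<^sup>2 * (\<Sum>k<n. (N k * \<epsilon> k)\<^sup>2) \<le> 1" for n
    proof -
      have term_le: "(N k * \<epsilon> k)\<^sup>2 \<le> C\<^sup>2 * exp (- 2 * L) * (1 / 2) ^ k" for k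
      proof -
        have "N k * \<epsilon> k = C * exp (- (3 * \<nu> / \<tau> + 2 * L) * \<rho> k)"
          by (simp add: N_def \<epsilon>_def a_def field_simps flip: exp_add)
        also have "\<dots> \<le> C * exp (- L * (1 + real k / 2))"
        proof -
          have "L * (1 + real k / 2) \<le> (3 * \<nu> / \<tau> + 2 * L) * \<rho> k"
            using L(1) pos \<tau> \<rho>_ge[of k] by (intro mult_mono) auto
          then have "- (3 * \<nu> / \<tau> + 2 * L) * \<rho> k \<le> - L * (1 + real k / 2)"
            by (simp only: mult_minus_left neg_le_iff_le)
          then have "exp (- (3 * \<nu> / \<tau> + 2 * L) * \<rho> k) \<le> exp (- L * (1 + real k / 2))"
            by (subst exp_le_cancel_iff)
          then show ?thesis by (rule mult_left_mono) (use pos in simp)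
        qed
        finally have "(N k * \<epsilon> k)\<^sup>2 \<le> (C * exp (- L * (1 + real k / 2)))\<^sup>2"
          using pos by (intro power_mono) (auto simp: N_def \<epsilon>_def)
        also have "\<dots> = C\<^sup>2 * exp (- 2 * L) * exp (- L) ^ k"
          by (simp add: power_mult_distrib field_simps flip: exp_double exp_add exp_of_nat_mult)
        also have "\<dots> \<le> C\<^sup>2 * exp (- 2 * L) * (1 / 2) ^ k"
        proof (intro mult_left_mono power_mono)
          have "2 \<le> exp L" using exp_ge_add_one_self[of L] L(1) by linarith
          then show "exp (- L) \<le> 1 / 2" by (simp add: exp_minus field_simps)
        qed auto
        finally show ?thesis .
      qed
      have geo: "(\<Sum>k<n. (1 / 2) ^ k) \<le> (2 :: real)"
        by (simp add: sum_gp_strict)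
      have "(\<Sum>k<n. (N k * \<epsilon> k)\<^sup>2) \<le> C\<^sup>2 * exp (- 2 * L) * (\<Sum>k<n. (1 / 2) ^ k)"
        unfolding sum_distrib_left by (intro sum_mono term_le)
      also have "\<dots> \<le> C\<^sup>2 * exp (- 2 * L) * 2"
        by (intro mult_left_mono geo) auto
      finally have "4 * \<beta>\<^sup>2 * (\<Sum>k<n. (N k * \<epsilon> k)\<^sup>2) \<le> 4 * \<beta>\<^sup>2 * (C\<^sup>2 * exp (- 2 * L) * 2)"
        by (intro mult_left_mono) auto
      also have "\<dots> = (8 * C\<^sup>2 * \<beta>\<^sup>2) * exp (- 2 * L)" by simp
      also have "\<dots> \<le> exp L * exp (- 2 * L)" by (intro mult_right_mono L(3)) simp
      also have "\<dots> \<le> 1" using L(1) by (simp flip: exp_add)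
      finally show ?thesis .
    qed
  qed
  show ?thesis
  proof (rule exI[of _ "\<epsilon> 0"], intro conjI exI[of _ "3 * \<tau>"] allI impI)
    fix t1 u0 assume "0 \<le> t1" "norm (S t1 u0 - \<phi>) \<le> \<epsilon> 0"
    then show "\<exists>p\<in>L2 (t1 + 3 * \<tau>). \<exists>u. trajectory (t1 + 3 * \<tau>) u0 p u \<and> u (t1 + 3 * \<tau>) = \<phi>"
      using newton_scheme.exact_control[OF scheme] by simp
  qed (use \<tau> in \<open>auto simp: \<epsilon>_def\<close>)
qed

end

section \<open>The shifted equation and its null controls\<close>

lemma C0_semigroup_rescale:
  fixes G :: "real \<Rightarrow> 'a::real_normed_vector \<Rightarrow> 'a"
  assumes G: "C0_semigroup G"
  shows "C0_semigroup (\<lambda>t x. exp (\<mu> * t) *\<^sub>R G t x)"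
  unfolding C0_semigroup_def
proof (intro conjI allI impI)
  show "bounded_linear (\<lambda>x. exp (\<mu> * t) *\<^sub>R G t x)" if "0 \<le> t" for t
    using C0_semigroupD(1)[OF G that] by (rule bounded_linear_const_scaleR)
  show "exp (\<mu> * 0) *\<^sub>R G 0 x = x" for x
    by (simp add: C0_semigroupD(2)[OF G])
  show "exp (\<mu> * (s + t)) *\<^sub>R G (s + t) x = exp (\<mu> * s) *\<^sub>R G s (exp (\<mu> * t) *\<^sub>R G t x)"
    if "0 \<le> s" "0 \<le> t" for s t x
    using C0_semigroupD(3)[OF G that, of x]
    by (simp add: linear_scale[OF bounded_linear.linear[OF C0_semigroupD(1)[OF G that(1)]]]
        distrib_left exp_add)
  show "((\<lambda>t. exp (\<mu> * t) *\<^sub>R G t x) \<longlongrightarrow> x) (at_right 0)" for x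
  proof -
    have "((\<lambda>t. exp (\<mu> * t) *\<^sub>R G t x) \<longlongrightarrow> exp (\<mu> * 0) *\<^sub>R x) (at_right 0)"
      by (intro tendsto_intros C0_semigroupD(4)[OF G])
    then show ?thesis by simp
  qed
qed

lemma steers_to_zeroD:
  assumes "steers_to_zero D A b T y p" "0 \<le> T"
  shows "exp_neg D A T y = (LINT s:{0..T}|lborel. exp_neg D A (T - s) (p s *\<^sub>R b))"
  using assms unfolding steers_to_zero_def mild_solution_def by force

text \<open>
  The cost is a supremum of infima over unit vectors, so a control within a factor \<open>2\<close> of
  the bound \<open>c\<close> exists; general initial values are reached by scaling.
\<close>

lemma control_of_cost:
  fixes D :: "'a::{real_inner, banach, second_countable_topology} set"
  assumes cost: "control_cost D A b \<tau> \<le> ereal c" and c: "0 < c" and \<tau>: "0 \<le> \<tau>"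
    and lin: "\<And>t. 0 \<le> t \<Longrightarrow> bounded_linear (exp_neg D A t)"
  shows "\<exists>p\<in>L2 \<tau>. L2_norm \<tau> p \<le> 2 * c * norm y \<and>
    exp_neg D A \<tau> y = (LINT s:{0..\<tau>}|lborel. exp_neg D A (\<tau> - s) (p s *\<^sub>R b))"
proof -
  let ?G = "exp_neg D A"
  note scale = linear_scale[OF bounded_linear.linear[OF lin]]
  have scaled: "\<exists>q\<in>L2 \<tau>. L2_norm \<tau> q \<le> 2 * c * (k * norm z) \<and>
      ?G \<tau> (k *\<^sub>R z) = (LINT s:{0..\<tau>}|lborel. ?G (\<tau> - s) (q s *\<^sub>R b))"
    if k: "0 \<le> k" and z: "norm z = 1" for k z
  proof -
    have "(INF p\<in>{p \<in> L2 \<tau>. steers_to_zero D A b \<tau> z p}. ereal (L2_norm \<tau> p)) \<le> ereal c"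
      using cost unfolding control_cost_def SUP_le_iff using z by blast
    also have "ereal c < ereal (2 * c)" using c by simp
    finally obtain p where p: "p \<in> L2 \<tau>" "steers_to_zero D A b \<tau> z p" "L2_norm \<tau> p < 2 * c"
      unfolding INF_less_iff by auto
    have eq: "indicator {0..\<tau>} s *\<^sub>R (k * p s) = k *\<^sub>R (indicator {0..\<tau>} s *\<^sub>R p s)" for s
      by simp
    have [measurable]: "(\<lambda>s. indicator {0..\<tau>} s *\<^sub>R p s) \<in> borel_measurable borel"
      using p(1) unfolding L2_def set_borel_measurable_def by simp
    have "set_borel_measurable lborel {0..\<tau>} (\<lambda>s. k * p s)"
      unfolding set_borel_measurable_def eq by measurable
    then have "(\<lambda>s. k * p s) \<in> L2 \<tau>"
      using p(1) unfolding L2_def by (auto simp: power_mult_distrib)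
    moreover have "L2_norm \<tau> (\<lambda>s. k * p s) = k * L2_norm \<tau> p"
      using k by (simp add: L2_norm_def power_mult_distrib real_sqrt_mult)
    then have "L2_norm \<tau> (\<lambda>s. k * p s) \<le> 2 * c * (k * norm z)"
      using mult_left_mono[OF less_imp_le[OF p(3)] k] z by (simp add: mult_ac)
    moreover have "?G \<tau> (k *\<^sub>R z) = (LINT s:{0..\<tau>}|lborel. ?G (\<tau> - s) ((k * p s) *\<^sub>R b))"
    proof -
      have "?G \<tau> (k *\<^sub>R z) = (LINT s:{0..\<tau>}|lborel. k *\<^sub>R ?G (\<tau> - s) (p s *\<^sub>R b))"
        by (simp add: scale[OF \<tau>] steers_to_zeroD[OF p(2) \<tau>])
      also have "\<dots> = (LINT s:{0..\<tau>}|lborel. ?G (\<tau> - s) ((k * p s) *\<^sub>R b))"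
        by (intro set_lebesgue_integral_cong) (auto simp: scale mult.commute)
      finally show ?thesis .
    qed
    ultimately show ?thesis by blast
  qed
  show ?thesis
  proof (cases "y = 0")
    case False
    then show ?thesis using scaled[of "norm y" "y /\<^sub>R norm y"] by simp
  next
    case True
    have "(\<lambda>_. 0) \<in> L2 \<tau>" "L2_norm \<tau> (\<lambda>_. 0) = 0"
      by (simp_all add: L2_def L2_norm_def set_borel_measurable_def set_integrable_def)
    moreover have "?G \<tau> 0 = (LINT s:{0..\<tau>}|lborel. ?G (\<tau> - s) (0 *\<^sub>R b))"
    proof -
      have "(LINT s:{0..\<tau>}|lborel. ?G (\<tau> - s) (0 *\<^sub>R b)) = (LINT s:{0..\<tau>}|lborel. 0)"
        by (intro set_lebesgue_integral_cong) (auto simp: linear_0[OF bounded_linear.linear[OF lin]])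
      then show ?thesis by (simp add: linear_0[OF bounded_linear.linear[OF lin]] \<tau>)
    qed
    ultimately show ?thesis using True by force
  qed
qed

lemma L2_exp_weight:
  assumes p: "p \<in> L2 \<tau>" and "0 \<le> \<mu>"
  shows "(\<lambda>s. exp (\<mu> * s) * p s) \<in> L2 \<tau>"
    and "L2_norm \<tau> (\<lambda>s. exp (\<mu> * s) * p s) \<le> exp (\<mu> * \<tau>) * L2_norm \<tau> p"
proof -
  have [measurable]: "(\<lambda>s. indicator {0..\<tau>} s *\<^sub>R p s) \<in> borel_measurable borel"
    and p2: "set_integrable lborel {0..\<tau>} (\<lambda>s. (p s)\<^sup>2)"
    using p unfolding L2_def set_borel_measurable_def by auto
  have eq: "indicator {0..\<tau>} s *\<^sub>R (exp (\<mu> * s) * p s) = exp (\<mu> * s) * (indicator {0..\<tau>} s *\<^sub>R p s)" for s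
    by simp
  have meas: "set_borel_measurable lborel {0..\<tau>} (\<lambda>s. exp (\<mu> * s) * p s)"
    unfolding set_borel_measurable_def eq by measurable
  have eq2: "indicator {0..\<tau>} s *\<^sub>R (exp (\<mu> * s) * p s)\<^sup>2 = (exp (\<mu> * s) * (indicator {0..\<tau>} s *\<^sub>R p s))\<^sup>2" for s
    by (simp add: power_mult_distrib indicator_def)
  have meas2: "set_borel_measurable lborel {0..\<tau>} (\<lambda>s. (exp (\<mu> * s) * p s)\<^sup>2)"
    unfolding set_borel_measurable_def eq2 by measurable
  have le: "(exp (\<mu> * s) * p s)\<^sup>2 \<le> (exp (\<mu> * \<tau>))\<^sup>2 * (p s)\<^sup>2" if "s \<in> {0..\<tau>}" for s
    using that \<open>0 \<le> \<mu>\<close> unfolding power_mult_distrib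
    by (intro mult_right_mono power_mono) (auto intro: mult_left_mono)
  have p2': "set_integrable lborel {0..\<tau>} (\<lambda>s. (exp (\<mu> * \<tau>))\<^sup>2 * (p s)\<^sup>2)"
    using p2 by simp
  have int: "set_integrable lborel {0..\<tau>} (\<lambda>s. (exp (\<mu> * s) * p s)\<^sup>2)"
    by (rule set_integrable_bound[OF p2' meas2])
      (use le in auto)
  then show "(\<lambda>s. exp (\<mu> * s) * p s) \<in> L2 \<tau>"
    using meas unfolding L2_def by blast
  have "(LINT s:{0..\<tau>}|lborel. (exp (\<mu> * s) * p s)\<^sup>2) \<le> (LINT s:{0..\<tau>}|lborel. (exp (\<mu> * \<tau>))\<^sup>2 * (p s)\<^sup>2)"
    by (rule set_integral_mono[OF int p2' le])
  also have "\<dots> = (exp (\<mu> * \<tau>))\<^sup>2 * (LINT s:{0..\<tau>}|lborel. (p s)\<^sup>2)"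
    by simp
  finally have "L2_norm \<tau> (\<lambda>s. exp (\<mu> * s) * p s) \<le> sqrt ((exp (\<mu> * \<tau>))\<^sup>2 * (LINT s:{0..\<tau>}|lborel. (p s)\<^sup>2))"
    unfolding L2_norm_def by (rule real_sqrt_le_mono)
  also have "\<dots> = exp (\<mu> * \<tau>) * L2_norm \<tau> p"
    by (simp add: real_sqrt_mult L2_norm_def)
  finally show "L2_norm \<tau> (\<lambda>s. exp (\<mu> * s) * p s) \<le> exp (\<mu> * \<tau>) * L2_norm \<tau> p" .
qed

context eigenbasis_operator
begin

text \<open>
  If \<open>l 0 = l 1\<close>, the eigenspace contains a vector \<open>y\<close> orthogonal to the control direction
  \<open>b\<close>, and no control affects the component along \<open>y\<close>.
\<close>

lemma spectral_gap:
  assumes steer: "\<And>y. \<exists>p. exp_neg D A 1 y = (LINT s:{0..1}|lborel. exp_neg D A (1 - s) (p s *\<^sub>R b))"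
  shows "l 0 \<noteq> l 1"
proof
  assume eq: "l 0 = l 1"
  define b0 b1 where "b0 = inner b (e 0)" and "b1 = inner b (e 1)"
  obtain \<alpha> \<gamma> where ne: "\<alpha> \<noteq> 0 \<or> \<gamma> \<noteq> 0" and orth: "\<alpha> * b0 + \<gamma> * b1 = 0"
    by (cases "b0 = 0 \<and> b1 = 0") (metis mult_zero_right add_0 zero_neq_one, metis add.right_inverse minus_mult_left mult.commute neg_equal_0_iff_equal)
  define y where "y = \<alpha> *\<^sub>R e 0 + \<gamma> *\<^sub>R e 1"
  have inner_y: "inner (exp_neg D A t x) y = exp (- l 0 * t) * inner x y" if "0 \<le> t" for t x
    unfolding y_def by (simp add: inner_add_right coeff_exp_neg[OF that] eq algebra_simps)
  obtain p where p: "exp_neg D A 1 y = (LINT s:{0..1}|lborel. exp_neg D A (1 - s) (p s *\<^sub>R b))"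
    using steer by blast
  have by0: "inner b y = 0"
    using orth by (simp add: y_def inner_add_right b0_def b1_def)
  have "inner (exp_neg D A 1 y) y = 0"
  proof (cases "set_integrable lborel {0..1} (\<lambda>s. exp_neg D A (1 - s) (p s *\<^sub>R b))")
    case True
    then have "inner (exp_neg D A 1 y) y =
        (LINT s|lborel. inner (indicator {0..1} s *\<^sub>R exp_neg D A (1 - s) (p s *\<^sub>R b)) y)"
      unfolding p set_lebesgue_integral_def set_integrable_def
      by (intro integral_inner_left[symmetric])
    moreover have "inner (indicator {0..1} s *\<^sub>R exp_neg D A (1 - s) (p s *\<^sub>R b)) y = 0" for s
      using inner_y[of "1 - s"] by (simp add: indicator_def by0)
    ultimately show ?thesis by (simp only: Bochner_Integration.integral_zero)
  next
    case False
    then show ?thesis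
      unfolding p set_lebesgue_integral_def set_integrable_def by (simp add: not_integrable_integral_eq)
  qed
  then have "y = 0" using inner_y[of 1 y] by simp
  moreover have "inner y (e 0) = \<alpha>" "inner y (e 1) = \<gamma>"
    by (simp_all add: y_def inner_add_left orthonormal)
  ultimately have "\<alpha> = 0" "\<gamma> = 0" by simp_all
  with ne show False by simp
qed

end

text \<open>
  With \<open>\<mu> = l 0\<close>, the shift \<open>u \<mapsto> e\<^sup>\<mu>\<^sup>t u\<close> replaces \<open>A\<close> by \<open>A - \<mu>\<close> and turns the eigensolution
  into the constant \<open>e 0\<close>. The semigroup of \<open>A - \<mu>\<close> is still contractive because \<open>\<mu>\<close> is the smallest
  eigenvalue.
\<close>

context eigenbasis_operator
begin

definition shifted :: "real \<Rightarrow> 'a \<Rightarrow> 'a" where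
  "shifted t x = exp (l 0 * t) *\<^sub>R exp_neg D A t x"

lemma coeff_shifted:
  "0 \<le> t \<Longrightarrow> inner (shifted t x) (e k) = exp (- (l k - l 0) * t) * inner x (e k)"
  by (simp add: shifted_def coeff_exp_neg left_diff_distrib flip: exp_add mult.assoc)

lemma contraction_semigroup_exp_neg: "contraction_semigroup (exp_neg D A)"
proof
  show "C0_semigroup (exp_neg D A)" by (rule C0_semigroup_exp_neg)
  show "norm (exp_neg D A t x) \<le> norm x" if "0 \<le> t" for t x
    using norm_le_of_coeffs[of "exp_neg D A t x" 1 x] that nonneg
    by (simp add: coeff_exp_neg abs_mult mult_left_le_one_le)
qed

lemma contraction_semigroup_shifted:
  assumes "\<And>k. l 0 \<le> l k"
  shows "contraction_semigroup shifted"
proof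
  show "C0_semigroup shifted"
    using C0_semigroup_rescale[OF C0_semigroup_exp_neg] unfolding shifted_def[abs_def] .
  show "norm (shifted t x) \<le> norm x" if t: "0 \<le> t" for t x
  proof -
    have "exp (- (l k - l 0) * t) \<le> 1" for k
      using mult_nonneg_nonneg[of "l k - l 0" t] assms[of k] t by (simp add: algebra_simps)
    then have "\<bar>inner (shifted t x) (e k)\<bar> \<le> 1 * \<bar>inner x (e k)\<bar>" for k
      unfolding coeff_shifted[OF t] abs_mult by (intro mult_right_mono) auto
    from norm_le_of_coeffs[OF this] show ?thesis by simp
  qed
qed

lemma shifted_equilibrium: "0 \<le> t \<Longrightarrow> shifted t (e 0) = e 0"
  by (rule basis_eqI) (simp add: coeff_shifted orthonormal)

text \<open>
  The error \<open>w - e 0\<close> has no component along \<open>e 0\<close>; all others decay at least at rate \<open>\<gamma>\<close>.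
\<close>

lemma shifted_decay:
  assumes gap: "\<And>k. 1 \<le> k \<Longrightarrow> \<gamma> \<le> l k - l 0" and t: "0 \<le> t" and w: "inner w (e 0) = 1"
  shows "norm (shifted t w - e 0) \<le> exp (- \<gamma> * t) * norm (w - e 0)"
proof (rule norm_le_of_coeffs)
  fix k
  show "\<bar>inner (shifted t w - e 0) (e k)\<bar> \<le> exp (- \<gamma> * t) * \<bar>inner (w - e 0) (e k)\<bar>"
  proof (cases "k = 0")
    case True
    then show ?thesis by (simp add: inner_diff_left coeff_shifted[OF t] w orthonormal)
  next
    case False
    then have "exp (- (l k - l 0) * t) \<le> exp (- \<gamma> * t)"
      using mult_right_mono[OF gap[of k] t] by (simp add: algebra_simps)
    then show ?thesis
      using False by (simp add: inner_diff_left coeff_shifted[OF t] orthonormal abs_mult mult_right_mono)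
  qed
qed simp

text \<open>
  Under the shift a control for the linear equation has to be weighted by \<open>e\<^sup>\<mu>\<^sup>s\<close>, since its direction
  \<open>b\<close> is fixed. In the bilinear equation the weight is carried by the state, and the control
  remains the same (\<open>mild_solution_of_shifted\<close>).
\<close>

lemma shifted_steering:
  assumes eq: "exp_neg D A \<tau> y = (LINT s:{0..\<tau>}|lborel. exp_neg D A (\<tau> - s) (p s *\<^sub>R b))" and \<tau>: "0 \<le> \<tau>"
  shows "shifted \<tau> y = (LINT s:{0..\<tau>}|lborel. shifted (\<tau> - s) ((exp (l 0 * s) * p s) *\<^sub>R b))"
proof -
  have "shifted \<tau> y = (LINT s:{0..\<tau>}|lborel. exp (l 0 * \<tau>) *\<^sub>R exp_neg D A (\<tau> - s) (p s *\<^sub>R b))"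
    by (simp add: shifted_def eq)
  also have "\<dots> = (LINT s:{0..\<tau>}|lborel. shifted (\<tau> - s) ((exp (l 0 * s) * p s) *\<^sub>R b))"
  proof (intro set_lebesgue_integral_cong allI impI)
    fix s assume "s \<in> {0..\<tau>}"
    then interpret G: bounded_linear "exp_neg D A (\<tau> - s)"
      using C0_semigroupD(1)[OF C0_semigroup_exp_neg] by simp
    show "exp (l 0 * \<tau>) *\<^sub>R exp_neg D A (\<tau> - s) (p s *\<^sub>R b) =
        shifted (\<tau> - s) ((exp (l 0 * s) * p s) *\<^sub>R b)"
      by (simp add: shifted_def G.scale right_diff_distrib flip: exp_add mult.assoc)
  qed simp
  finally show ?thesis .
qed

lemma mild_solution_of_shifted:
  assumes B: "bounded_linear B" and p: "set_integrable lborel {0..T} p"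
    and u: "continuous_on {0..T} u"
      "\<And>t. t \<in> {0..T} \<Longrightarrow> u t = shifted t w - (LINT s:{0..t}|lborel. shifted (t - s) (p s *\<^sub>R B (u s)))"
  shows "mild_solution D A T (c *\<^sub>R w) (\<lambda>t. p t *\<^sub>R B ((c * exp (- l 0 * t)) *\<^sub>R u t))
    (\<lambda>t. (c * exp (- l 0 * t)) *\<^sub>R u t)"
  unfolding mild_solution_def
proof (intro conjI ballI)
  interpret G: contraction_semigroup "exp_neg D A" by (rule contraction_semigroup_exp_neg)
  interpret B: bounded_linear B by (rule B)
  let ?U = "\<lambda>t. (c * exp (- l 0 * t)) *\<^sub>R u t"
  show cont: "continuous_on {0..T} ?U"
    by (intro continuous_intros u(1))
  fix t assume t: "t \<in> {0..T}"
  have "set_integrable lborel {0..T} (\<lambda>s. p s *\<^sub>R B (?U s))"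
    by (rule set_integrable_scaleR_continuous[OF p B.continuous_on[OF cont]])
  then have "set_integrable lborel {0..t} (\<lambda>s. p s *\<^sub>R B (?U s))"
    by (rule set_integrable_subset) (use t in auto)
  then show "set_integrable lborel {0..t} (\<lambda>s. exp_neg D A (t - s) (p s *\<^sub>R B (?U s)))"
    by (rule G.duhamel_integrable)
  interpret Gt: bounded_linear "exp_neg D A t" using G.linear_S t by simp
  have "?U t = (c * exp (- l 0 * t)) *\<^sub>R shifted t w -
      (LINT s:{0..t}|lborel. (c * exp (- l 0 * t)) *\<^sub>R shifted (t - s) (p s *\<^sub>R B (u s)))"
    by (simp add: u(2)[OF t] scaleR_diff_right)
  also have "(c * exp (- l 0 * t)) *\<^sub>R shifted t w = exp_neg D A t (c *\<^sub>R w)"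
    by (simp add: shifted_def Gt.scale exp_minus)
  also have "(LINT s:{0..t}|lborel. (c * exp (- l 0 * t)) *\<^sub>R shifted (t - s) (p s *\<^sub>R B (u s))) =
      (LINT s:{0..t}|lborel. exp_neg D A (t - s) (p s *\<^sub>R B (?U s)))"
  proof (intro set_lebesgue_integral_cong allI impI)
    fix s assume "s \<in> {0..t}"
    then interpret Gs: bounded_linear "exp_neg D A (t - s)" using G.linear_S by simp
    have "exp (- l 0 * t) * exp (l 0 * (t - s)) = exp (- l 0 * s)"
      by (simp add: algebra_simps flip: exp_add)
    then have "c * exp (- l 0 * t) * exp (l 0 * (t - s)) = c * exp (- l 0 * s)"
      by (simp only: mult.assoc)
    moreover have "(c * exp (- l 0 * t)) *\<^sub>R shifted (t - s) (p s *\<^sub>R B (u s)) =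
        (c * exp (- l 0 * t) * exp (l 0 * (t - s))) *\<^sub>R exp_neg D A (t - s) (p s *\<^sub>R B (u s))"
      by (simp only: shifted_def scaleR_scaleR)
    moreover have "exp_neg D A (t - s) (p s *\<^sub>R B (?U s)) =
        (c * exp (- l 0 * s)) *\<^sub>R exp_neg D A (t - s) (p s *\<^sub>R B (u s))"
      by (simp add: B.scale Gs.scale mult.commute)
    ultimately show "(c * exp (- l 0 * t)) *\<^sub>R shifted (t - s) (p s *\<^sub>R B (u s)) =
        exp_neg D A (t - s) (p s *\<^sub>R B (?U s))"
      by (simp only:)
  qed simp
  finally show "?U t = exp_neg D A t (c *\<^sub>R w) -
      (LINT s:{0..t}|lborel. exp_neg D A (t - s) (p s *\<^sub>R B (?U s)))" .
qed

end

section \<open>Exact controllability to the first eigensolution\<close>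

theorem theorem1p5:
  fixes D :: "'a::{real_inner, banach, second_countable_topology} set"
    and A B :: "'a \<Rightarrow> 'a" and lam :: "nat \<Rightarrow> real" and \<phi> :: "nat \<Rightarrow> 'a" and \<nu> T0 :: real
  assumes "linear_operator_on D A" and "densely_defined D"
    and "self_adjoint D A"
    and "\<forall>x\<in>D. inner (A x) x \<ge> 0"
    and "\<exists>\<mu>>0. has_compact_inverse D (\<lambda>x. \<mu> *\<^sub>R x + A x)"
    and "eigenbasis D A lam \<phi>"
    and "bounded_linear B"
    and "\<forall>T>0. one_null_controllable D A (B (\<phi> 1)) T"
    and "\<nu> > 0" and "T0 > 0"
    and "\<forall>\<tau>. 0 < \<tau> \<and> \<tau> \<le> T0 \<longrightarrow> control_cost D A (B (\<phi> 1)) \<tau> \<le> ereal (exp (\<nu> / \<tau>))"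
  shows "\<forall>R>0. \<exists>T\<^sub>R>0. \<forall>u0.
    norm (u0 - inner u0 (\<phi> 1) *\<^sub>R \<phi> 1) \<le> R * \<bar>inner u0 (\<phi> 1)\<bar> \<longrightarrow>
    exactly_controllable_to D A B T\<^sub>R u0 (\<lambda>t. inner u0 (\<phi> 1) *\<^sub>R eigensolution lam \<phi> 1 t)"
proof -
  define e where "e k = \<phi> (Suc k)" for k
  define l where "l k = lam (Suc k)" for k
  have range_e: "\<phi> ` {1..} = range e"
    unfolding e_def image_def by (auto intro: exI[of _ "_ - 1"] simp: Bex_def)
      (metis Suc_diff_1 less_eq_Suc_le)
  interpret eigenbasis_operator e D A l
    by unfold_locales
      (use assms(2,3,6) range_e in \<open>auto simp: eigenbasis_def orthonormal_basis_seq_def e_def l_def\<close>)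
  have e0: "\<phi> 1 = e 0" and l0: "lam 1 = l 0" by (simp_all add: e_def l_def)
  have l_Suc: "l n \<le> l (Suc n)" for n
    using assms(6) unfolding eigenbasis_def l_def by simp
  have l_mono: "l m \<le> l n" if "m \<le> n" for m n
    using lift_Suc_mono_le[of l, OF l_Suc that] .
  obtain \<beta> where \<beta>: "\<beta> > 0" "\<And>x. norm (B x) \<le> norm x * \<beta>"
    using bounded_linear.pos_bounded[OF assms(7)] by blast
  interpret flow: contraction_semigroup shifted
    by (rule contraction_semigroup_shifted) (simp add: l_mono)
  interpret flow: bilinear_system shifted B \<beta>
    by (intro bilinear_system.intro bilinear_system_axioms.intro flow.contraction_semigroup_axioms)
      (use assms(7) \<beta> in \<open>simp_all add: mult.commute\<close>)
  have "l 0 \<noteq> l 1"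
  proof (rule spectral_gap)
    fix y
    obtain p where "steers_to_zero D A (B (e 0)) 1 y p"
      using assms(8) unfolding one_null_controllable_def e0 by (meson zero_less_one)
    then show "\<exists>p. exp_neg D A 1 y = (LINT s:{0..1}|lborel. exp_neg D A (1 - s) (p s *\<^sub>R B (e 0)))"
      using steers_to_zeroD zero_le_one by blast
  qed
  define \<gamma> where "\<gamma> = l 1 - l 0"
  have \<gamma>: "0 < \<gamma>" "\<And>k. 1 \<le> k \<Longrightarrow> \<gamma> \<le> l k - l 0"
    using \<open>l 0 \<noteq> l 1\<close> l_mono[of 0 1] l_mono[of 1] by (auto simp: \<gamma>_def)
  \<comment> \<open>The factor \<open>2\<close> is lost in the infimum, the exponential in the shift.\<close>
  define C where "C = 2 * exp (l 0 * T0)"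
  have "1 \<le> exp (l 0 * T0)"
    using mult_nonneg_nonneg[OF nonneg less_imp_le[OF assms(10)], of 0] by simp
  then have C: "1 \<le> C" unfolding C_def by linarith
  have null: "\<exists>q\<in>L2 \<tau>. L2_norm \<tau> q \<le> C * exp (\<nu> / \<tau>) * norm z \<and>
      shifted \<tau> z = flow.duhamel \<tau> (\<lambda>s. q s *\<^sub>R B (e 0))" if \<tau>: "0 < \<tau>" "\<tau> \<le> T0" for \<tau> z
  proof -
    have cost: "control_cost D A (B (e 0)) \<tau> \<le> ereal (exp (\<nu> / \<tau>))"
      using assms(11) \<tau> unfolding e0 by blast
    obtain p where p: "p \<in> L2 \<tau>" "L2_norm \<tau> p \<le> 2 * exp (\<nu> / \<tau>) * norm z"
      "exp_neg D A \<tau> z = (LINT s:{0..\<tau>}|lborel. exp_neg D A (\<tau> - s) (p s *\<^sub>R B (e 0)))"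
      using control_of_cost[OF cost exp_gt_zero less_imp_le[OF \<tau>(1)] C0_semigroupD(1)[OF C0_semigroup_exp_neg], of z]
      by blast
    have "L2_norm \<tau> (\<lambda>s. exp (l 0 * s) * p s) \<le> exp (l 0 * \<tau>) * L2_norm \<tau> p"
      by (rule L2_exp_weight(2)[OF p(1) nonneg])
    also have "\<dots> \<le> exp (l 0 * T0) * (2 * exp (\<nu> / \<tau>) * norm z)"
      using p(2) \<tau> nonneg[of 0]
      by (intro mult_mono) (auto intro: mult_left_mono simp: L2_norm_def set_lebesgue_integral_def)
    also have "\<dots> = C * exp (\<nu> / \<tau>) * norm z" by (simp add: C_def)
    finally show ?thesis
      using L2_exp_weight(1)[OF p(1) nonneg[of 0]] shifted_steering[OF p(3) less_imp_le[OF \<tau>(1)]]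
      unfolding flow.duhamel_def by blast
  qed
  have norm_e: "norm (e 0) = 1" using orthonormal[of 0 0] by (simp add: norm_eq_sqrt_inner)
  obtain \<delta> T where \<delta>: "0 < \<delta>" and T: "0 < T" and steer: "\<And>t1 w. 0 \<le> t1 \<Longrightarrow> norm (shifted t1 w - e 0) \<le> \<delta> \<Longrightarrow>
      \<exists>p\<in>L2 (t1 + T). \<exists>u. flow.trajectory (t1 + T) w p u \<and> u (t1 + T) = e 0"
    using flow.local_exact_control[OF shifted_equilibrium norm_e C assms(9,10) null] by blast
  show ?thesis
  proof (intro allI impI)
    fix R :: real assume R: "0 < R"
    \<comment> \<open>Waiting time; \<open>x \<le> e\<^sup>x\<close> at \<open>x = R / \<delta>\<close> shows that it suffices.\<close>
    define t1 where "t1 = R / (\<delta> * \<gamma>)"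
    have t1: "0 < t1" using R \<delta> \<gamma>(1) by (simp add: t1_def)
    have decay: "exp (- \<gamma> * t1) * R \<le> \<delta>"
    proof -
      have "R / \<delta> = \<gamma> * t1" using \<gamma>(1) by (simp add: t1_def)
      also have "\<dots> \<le> exp (\<gamma> * t1)" using exp_ge_add_one_self[of "\<gamma> * t1"] by linarith
      finally have "R / \<delta> \<le> exp (\<gamma> * t1)" .
      then show ?thesis using \<delta> by (simp add: exp_minus field_simps)
    qed
    show "\<exists>T\<^sub>R>0. \<forall>u0. norm (u0 - inner u0 (\<phi> 1) *\<^sub>R \<phi> 1) \<le> R * \<bar>inner u0 (\<phi> 1)\<bar> \<longrightarrow>
        exactly_controllable_to D A B T\<^sub>R u0 (\<lambda>t. inner u0 (\<phi> 1) *\<^sub>R eigensolution lam \<phi> 1 t)"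
    proof (intro exI[of _ "t1 + T"] conjI allI impI)
      show "0 < t1 + T" using t1 T by simp
      fix u0 assume "norm (u0 - inner u0 (\<phi> 1) *\<^sub>R \<phi> 1) \<le> R * \<bar>inner u0 (\<phi> 1)\<bar>"
      moreover define c where "c = inner u0 (e 0)"
      ultimately have near: "norm (u0 - c *\<^sub>R e 0) \<le> R * \<bar>c\<bar>" unfolding e0 by simp
      \<comment> \<open>If \<open>c = 0\<close> then \<open>u0 = 0\<close>, and any normalised \<open>w\<close> near \<open>e 0\<close> serves.\<close>
      define w where "w = (if c = 0 then e 0 else u0 /\<^sub>R c)"
      have u0: "u0 = c *\<^sub>R w"
        using near by (auto simp: w_def)
      have w1: "inner w (e 0) = 1"
        by (simp add: w_def orthonormal c_def[symmetric])
      have "norm (w - e 0) \<le> R"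
      proof (cases "c = 0")
        case False
        have "\<bar>c\<bar> * norm (w - e 0) = norm (u0 - c *\<^sub>R e 0)"
          by (simp add: u0 flip: norm_scaleR scaleR_diff_right)
        also have "\<dots> \<le> \<bar>c\<bar> * R"
          using near by (simp add: mult.commute)
        finally show ?thesis using False by simp
      qed (use R in \<open>simp add: w_def\<close>)
      then have "norm (shifted t1 w - e 0) \<le> \<delta>"
        using order_trans[OF shifted_decay[OF \<gamma>(2) less_imp_le[OF t1] w1] order_trans[OF mult_left_mono decay]]
        by simp
      then obtain p u where p: "p \<in> L2 (t1 + T)" and u: "flow.trajectory (t1 + T) w p u" "u (t1 + T) = e 0"
        using steer t1 by (meson less_imp_le)
      have p1: "set_integrable lborel {0..t1 + T} p"
        by (rule cauchy_schwarz_interval(1)) (use p t1 T in \<open>auto simp: L2_def\<close>)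
      have "mild_solution D A (t1 + T) u0 (\<lambda>t. p t *\<^sub>R B ((c * exp (- l 0 * t)) *\<^sub>R u t))
          (\<lambda>t. (c * exp (- l 0 * t)) *\<^sub>R u t)"
        unfolding u0
        by (rule mild_solution_of_shifted[OF assms(7) p1])
          (use u(1) in \<open>simp_all add: flow.trajectory_def flow.duhamel_def\<close>)
      moreover have "(c * exp (- l 0 * (t1 + T))) *\<^sub>R u (t1 + T) = c *\<^sub>R exp (- l 0 * (t1 + T)) *\<^sub>R e 0"
        by (simp add: u(2))
      ultimately show "exactly_controllable_to D A B (t1 + T) u0 (\<lambda>t. inner u0 (\<phi> 1) *\<^sub>R eigensolution lam \<phi> 1 t)"
        unfolding exactly_controllable_to_def eigensolution_def e0 l0 c_def[symmetric]
        by (intro bexI[OF _ p] exI[of _ "\<lambda>t. (c * exp (- l 0 * t)) *\<^sub>R u t"] conjI)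
    qed
  qed
qed

end
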